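(* Suppose that the Markov chain $(X_t)_{t\ge0}$ on $\mathcal{X}$ with transition kernel $P$ has a drift function with respect to a small set $C\subset\mathcal{X}$. Let $V$, $0<\lambda<1$, $K<\infty$ be the data associated with the drift function, and let $\nu$, $m\ge 1$, $\varepsilon>0$ be the data associated with the small set. Let $T$ be the random time constructed from $C,\nu,m,\varepsilon$ by the coin-flipping algorithm given in the context. Then $\mathbf{P}_\mu(T<\infty)=1$ for all probability measures $\mu$ on $\mathcal{X}$. If $\mu(V)<\infty$, then \[ \mathbf{P}_\mu(T>t)\le \mu(V)^r\rho^{\,t+1-m}\qquad\text{for all integers } t\ge 0, \] where $\rho,r$ are as follows. Let \[ B=\frac{1-\lambda^m}{1-\lambda}(K-\lambda)+\lambda^m . \] If $\varepsilon=1$, then $\rho=\lambda$ and $r=1$. If $\varepsilon<1$, then \[ \rho=\max\left\{\lambda,\ \exp\left(\frac{-\log(1-\varepsilon)\log\lambda}{-m\log\lambda+\log(B-\varepsilon)-\log(1-\varepsilon)}\right)\right\},\qquad r=\frac{\log\rho}{\log\lambda}. \] We have $\rho<1$. In addition, whether $\varepsilon=1$ or $\varepsilon<1$, the measure $\nu$ satisfies \[ \nu(V)\le\frac{B-(1-\varepsilon)}{\varepsilon}. \]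
   Context: $\mathcal{X}$ is a general (measurable) state space; all subsets and functions considered are measurable. $\mathbf{P}_\mu$ denotes probability for the chain (jointly with $T$) started from $X_0\sim\mu$. Notation: $Pf(x)=\int f(y)P(x,dy)$, $\mu(f)=\int f\,d\mu$, and $P^m(x,\cdot)$ is the $m$-step transition law from $x$. Drift function: a function $V:\mathcal{X}\to[1,\infty)$ together with constants $\lambda$ ($0<\lambda<1$) and $K<\infty$ such that $PV(x)\le\lambda V(x)$ for $x\notin C$ and $PV(x)\le K$ for $x\in C$ is a drift function for $(X_t)$ with respect to $C$. Small set: $C\subset\mathcal{X}$ is a small set if there are an integer $m\ge1$, a constant $\varepsilon>0$ and a probability measure $\nu$ on $\mathcal{X}$ such that $P^m(x,S)\ge\varepsilon\nu(S)$ for all $x\in C$ and $S\subset\mathcal{X}$. Construction of $T$ (jointly with the chain): 1. Start with $X_0\sim\mu$ and $n=0$. 2. While $X_n\notin C$: sample $X_{n+1}\sim P(X_n,\cdot)$ and replace $n$ with $n+1$. 3. Once $X_n\in C$, flip a coin (independent of everything so far) with heads probability $\varepsilon$ and tails probability $1-\varepsilon$. 4. If the coin shows heads, sample $X_{n+m}\sim\nu$ and set $T=n+m$. 5. If the coin shows tails, sample $X_{n+m}$ from the remainder distribution $\frac{1}{1-\varepsilon}[P^m(X_n,\cdot)-\varepsilon\nu(\cdot)]$. 6. If $m>1$, sample $(X_{n+1},\ldots,X_{n+m-1})$ from the correct conditional distribution (that of the chain with kernel $P$) given $X_n$ and $X_{n+m}$. 7. Replace $n$ with $n+m$. 8. If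 the coin showed tails, return to step 2. 9. If the coin showed heads, sample the rest of the chain $(X_{n+1},X_{n+2},\ldots)$ from the correct conditional distribution given $X_n$. If the entire chain is sampled without ever reaching step 4, set $T=\infty$. Under this construction $(X_t)$ is the Markov chain with kernel $P$ started from $\mu$. *)

theory Defs
  imports "HOL-Probability.Probability"
begin

text \<open>Transition kernels on a measurable space \<open>M\<close> are measurable maps
  \<open>P \<in> M \<rightarrow>\<^sub>M prob_algebra M\<close>.\<close>

primrec kernel_power :: "'a measure \<Rightarrow> ('a \<Rightarrow> 'a measure) \<Rightarrow> nat \<Rightarrow> 'a \<Rightarrow> 'a measure" where
  "kernel_power M P 0 x = return M x"
| "kernel_power M P (Suc k) x = kernel_power M P k x \<bind> P"

definition drift_function ::
  "'a measure \<Rightarrow> ('a \<Rightarrow> 'a measure) \<Rightarrow> 'a set \<Rightarrow> ('a \<Rightarrow> real) \<Rightarrow> real \<Rightarrow> real \<Rightarrow> bool" where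
  "drift_function M P C V lam K \<longleftrightarrow>
     V \<in> borel_measurable M \<and> (\<forall>x\<in>space M. 1 \<le> V x) \<and> 0 < lam \<and> lam < 1 \<and>
     (\<forall>x\<in>space M - C. (\<integral>\<^sup>+ y. ennreal (V y) \<partial>P x) \<le> ennreal (lam * V x)) \<and>
     (\<forall>x\<in>C. (\<integral>\<^sup>+ y. ennreal (V y) \<partial>P x) \<le> ennreal K)"

definition small_set ::
  "'a measure \<Rightarrow> ('a \<Rightarrow> 'a measure) \<Rightarrow> 'a set \<Rightarrow> nat \<Rightarrow> real \<Rightarrow> 'a measure \<Rightarrow> bool" where
  "small_set M P C m \<epsilon> \<nu> \<longleftrightarrow>
     C \<in> sets M \<and> 1 \<le> m \<and> 0 < \<epsilon> \<and> \<nu> \<in> space (prob_algebra M) \<and>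
     (\<forall>x\<in>C. \<forall>S\<in>sets M. ennreal \<epsilon> * emeasure \<nu> S \<le> emeasure (kernel_power M P m x) S)"

text \<open>Law of \<open>X\<^sub>0, \<dots>, X\<^sub>k\<close> for the chain started from \<open>x\<close>, carried by infinite sequences whose
  coordinates beyond \<open>k\<close> are padded with the meaningless value \<open>x\<close>.\<close>

primrec path_law ::
  "'a measure \<Rightarrow> ('a \<Rightarrow> 'a measure) \<Rightarrow> nat \<Rightarrow> 'a \<Rightarrow> (nat \<Rightarrow> 'a) measure" where
  "path_law M P 0 x = return (\<Pi>\<^sub>M i\<in>UNIV. M) (\<lambda>_. x)"
| "path_law M P (Suc k) x =
     path_law M P k x \<bind>
       (\<lambda>w. P (w k) \<bind> (\<lambda>y. return (\<Pi>\<^sub>M i\<in>UNIV. M) (w(Suc k := y))))"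

text \<open>\<open>Q (x, y)\<close> is the conditional distribution of \<open>(X\<^sub>1, \<dots>, X\<^bsub>m-1\<^esub>)\<close> given \<open>X\<^sub>0 = x\<close> and
  \<open>X\<^sub>m = y\<close>: sampling \<open>y\<close> from \<open>P\<^sup>m(x, \<cdot>)\<close> and then the intermediate states from \<open>Q (x, y)\<close>
  gives the law of the chain. Only starting points in \<open>C\<close> matter. For \<open>m = 1\<close> the product
  space is a single point and \<open>Q\<close> carries no information. On a general measurable space \<open>Q\<close> is
  not unique, and for \<open>m > 1\<close> it need not exist, so it is a datum of the construction.\<close>

definition bridge_kernel ::
  "'a measure \<Rightarrow> ('a \<Rightarrow> 'a measure) \<Rightarrow> 'a set \<Rightarrow> nat \<Rightarrow> ('a \<times> 'a \<Rightarrow> (nat \<Rightarrow> 'a) measure) \<Rightarrow> bool"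
where
  "bridge_kernel M P C m Q \<longleftrightarrow>
     Q \<in> M \<Otimes>\<^sub>M M \<rightarrow>\<^sub>M prob_algebra (\<Pi>\<^sub>M i\<in>{1..<m}. M) \<and>
     (\<forall>x\<in>C.
        kernel_power M P m x \<bind>
          (\<lambda>y. Q (x, y) \<bind> (\<lambda>z. return (M \<Otimes>\<^sub>M (\<Pi>\<^sub>M i\<in>{1..<m}. M)) (y, z))) =
        distr (path_law M P m x) (M \<Otimes>\<^sub>M (\<Pi>\<^sub>M i\<in>{1..<m}. M)) (\<lambda>w. (w m, restrict w {1..<m})))"

text \<open>For \<open>\<epsilon> = 1\<close> this is the zero measure; tails then has probability zero.\<close>

definition remainder_law ::
  "'a measure \<Rightarrow> ('a \<Rightarrow> 'a measure) \<Rightarrow> nat \<Rightarrow> real \<Rightarrow> 'a measure \<Rightarrow> 'a \<Rightarrow> 'a measure" where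
  "remainder_law M P m \<epsilon> \<nu> x =
     scale_measure (ennreal (1 / (1 - \<epsilon>)))
       (diff_measure (kernel_power M P m x) (scale_measure (ennreal \<epsilon>) \<nu>))"

text \<open>The sampling algorithm is a Markov chain of program states \<open>(n, x, \<tau>)\<close>: \<open>n\<close> is the current
  time, \<open>x 0, \<dots>, x n\<close> are the states of the chain sampled so far (later entries of \<open>x\<close> are
  meaningless), and \<open>\<tau>\<close> is the value assigned to \<open>T\<close>, with \<open>\<infinity>\<close> meaning not assigned yet.\<close>

type_synonym 'a prog_state = "nat \<times> (nat \<Rightarrow> 'a) \<times> enat"

definition state_space :: "'a measure \<Rightarrow> 'a prog_state measure" where
  "state_space M = count_space UNIV \<Otimes>\<^sub>M (\<Pi>\<^sub>M i\<in>UNIV. M) \<Otimes>\<^sub>M count_space UNIV"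

definition init_law :: "'a measure \<Rightarrow> 'a measure \<Rightarrow> 'a prog_state measure" where
  "init_law M \<mu> = distr \<mu> (state_space M) (\<lambda>x. (0, \<lambda>_. x, \<infinity>))"

text \<open>One round. The first branch flips the coin, samples \<open>y = X\<^bsub>n+m\<^esub>\<close> and then the intermediate
  states \<open>z i = X\<^bsub>n+i\<^esub>\<close>, \<open>0 < i < m\<close>. The second branch is a single transition of the chain,
  performed outside \<open>C\<close> and always once \<open>T\<close> has been assigned.\<close>

definition round_kernel ::
  "'a measure \<Rightarrow> ('a \<Rightarrow> 'a measure) \<Rightarrow> 'a set \<Rightarrow> nat \<Rightarrow> real \<Rightarrow> 'a measure \<Rightarrow>
   ('a \<times> 'a \<Rightarrow> (nat \<Rightarrow> 'a) measure) \<Rightarrow> 'a prog_state \<Rightarrow> 'a prog_state measure" where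
  "round_kernel M P C m \<epsilon> \<nu> Q = (\<lambda>(n, x, \<tau>).
     if \<tau> = \<infinity> \<and> x n \<in> C then
       measure_pmf (bernoulli_pmf \<epsilon>) \<bind> (\<lambda>heads.
         (if heads then \<nu> else remainder_law M P m \<epsilon> \<nu> (x n)) \<bind> (\<lambda>y.
           Q (x n, y) \<bind> (\<lambda>z.
             return (state_space M)
               (n + m,
                (\<lambda>k. if n < k \<and> k < n + m then z (k - n) else if k = n + m then y else x k),
                if heads then enat (n + m) else \<infinity>))))
     else
       P (x n) \<bind> (\<lambda>y. return (state_space M) (n + 1, x(n + 1 := y), \<tau>)))"

text \<open>Law of the infinite sequence of program states, by the Ionescu-Tulcea theorem.\<close>

definition run_law ::
  "'a measure \<Rightarrow> ('a \<Rightarrow> 'a measure) \<Rightarrow> 'a set \<Rightarrow> nat \<Rightarrow> real \<Rightarrow> 'a measure \<Rightarrow>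
   ('a \<times> 'a \<Rightarrow> (nat \<Rightarrow> 'a) measure) \<Rightarrow> 'a measure \<Rightarrow> (nat \<Rightarrow> 'a prog_state) measure" where
  "run_law M P C m \<epsilon> \<nu> Q \<mu> =
     projective_family.lim UNIV
       (Ionescu_Tulcea.CI
         (\<lambda>k \<omega>. if k = 0 then init_law M \<mu> else round_kernel M P C m \<epsilon> \<nu> Q (\<omega> (k - 1)))
         (\<lambda>_. state_space M))
       (\<lambda>_. state_space M)"

text \<open>The recorded value changes at most once along a run, from \<open>\<infinity>\<close> to \<open>T\<close>; hence the infimum.\<close>

definition regen_time :: "(nat \<Rightarrow> 'a prog_state) \<Rightarrow> enat" where
  "regen_time \<omega> = (INF k. snd (snd (\<omega> k)))"

definition drift_B :: "real \<Rightarrow> real \<Rightarrow> nat \<Rightarrow> real" where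
  "drift_B lam K m = (1 - lam ^ m) / (1 - lam) * (K - lam) + lam ^ m"

definition drift_rho :: "real \<Rightarrow> real \<Rightarrow> nat \<Rightarrow> real \<Rightarrow> real" where
  "drift_rho lam K m \<epsilon> =
     (if \<epsilon> = 1 then lam
      else max lam (exp ((- ln (1 - \<epsilon>) * ln lam) /
        (- real m * ln lam + ln (drift_B lam K m - \<epsilon>) - ln (1 - \<epsilon>)))))"

definition drift_r :: "real \<Rightarrow> real \<Rightarrow> nat \<Rightarrow> real \<Rightarrow> real" where
  "drift_r lam K m \<epsilon> = (if \<epsilon> = 1 then 1 else ln (drift_rho lam K m \<epsilon>) / ln lam)"

end

theory Submission
  imports Defs
begin

text \<open>The drift condition makes \<open>V\<close> shrink by the factor \<open>lam\<close> outside \<open>C\<close>, but a failed coin flip can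
raise it: the mean of \<open>V\<close> under the remainder law is only bounded by \<open>(B - \<epsilon>) / (1 - \<epsilon>)\<close>, because
\<open>P\<^sup>m V \<le> B\<close> on \<open>C\<close> (\<open>kernel_power_V_le\<close>) and the part \<open>\<epsilon> \<nu>\<close> of \<open>P\<^sup>m\<close> uses up at least \<open>\<epsilon>\<close> of it. The
factor \<open>1 - \<epsilon>\<close>, the probability of failing, has to pay for this. Passing from \<open>V\<close> to a power \<open>V\<^sup>r\<close>
with \<open>r \<le> 1\<close> balances the two effects. By Jensen's inequality the contraction outside \<open>C\<close> becomes
\<open>lam\<^sup>r = \<rho>\<close> per step, and a failed round in \<open>C\<close> contributes at most
\<open>(1 - \<epsilon>) ((B - \<epsilon>) / (1 - \<epsilon>))\<^sup>r\<close>. The rate \<open>\<rho>\<close> is chosen so that \<open>r\<close> is the largest exponent up to \<open>1\<close>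
for which this is at most \<open>\<rho>\<^sup>m = lam\<^sup>m\<^sup>r\<close> (\<open>drift_rate\<close>), the decay due for the \<open>m\<close> time steps of the round.

Hence \<open>\<rho>\<^sup>-\<^sup>n V(X\<^sub>n)\<^sup>r\<close>, killed when heads comes up, is a supermartingale along the rounds of the
algorithm. The event \<open>T \<ge> N + m\<close> says that every coin flipped before time \<open>N\<close> shows tails, which suggests
\<open>\<rho>\<^sup>N V(X\<^sub>0)\<^sup>r\<close> as a bound for its probability; a further use of Jensen's inequality replaces the mean
of \<open>V\<^sup>r\<close> by the power of the mean of \<open>V\<close>.

Stopping at the first round that starts at or after time \<open>N\<close> is built into the supermartingale
itself: \<open>survival_bound\<close> is a function of the current program state which does not increase in mean
(\<open>survival_bound_round\<close>) and which is \<open>1\<close> as soon as the clock has reached \<open>N\<close> without heads. Since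
every round advances the clock, \<open>N\<close> rounds are enough (\<open>clock_lag\<close>), and the probability of
\<open>T \<ge> N + m\<close> is read off from the law of the program state after \<open>N\<close> rounds (\<open>survival_le\<close>).
The bound is truncated at \<open>1\<close>, so dominated convergence gives \<open>T < \<infinity>\<close> almost surely for every
initial law, also when the mean of \<open>V\<close> is infinite. The estimate of \<open>\<nu>(V)\<close> comes from the same
decomposition of \<open>P\<^sup>m\<close>, as the remainder law gives \<open>V\<close> a mean of at least \<open>1\<close>.\<close>

section \<open>Jensen bound and weighted averages\<close>

text \<open>The right-hand side is the tangent line of the concave function \<open>x powr r\<close> at \<open>a\<close>; this is Young's
inequality for \<open>x / a\<close> and \<open>1\<close>.\<close>

lemma powr_le_tangent:
  fixes a x r :: real
  assumes "0 < a" "0 < x" "0 \<le> r" "r \<le> 1"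
  shows "x powr r \<le> a powr r * (1 - r) + a powr r * r / a * x"
proof -
  have "(x / a) powr r * 1 powr (1 - r) \<le> r * (x / a) + (1 - r) * 1"
    using assms by (intro Youngs_inequality_0) auto
  then have "a powr r * (x / a) powr r \<le> a powr r * (r * (x / a) + (1 - r))"
    by (intro mult_left_mono) auto
  moreover have "a powr r * (x / a) powr r = x powr r"
    using assms by (simp flip: powr_mult)
  ultimately show ?thesis by (simp add: algebra_simps)
qed

text \<open>Jensen's inequality for a concave power, obtained by integrating the tangent line at \<open>a\<close>. An
upper bound \<open>a\<close> takes the place of the mean, as this is what drift inequalities provide.\<close>

lemma (in prob_space) nn_integral_powr_le:
  assumes V[measurable]: "V \<in> borel_measurable M" and pos: "\<And>x. x \<in> space M \<Longrightarrow> 0 < V x"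
    and r: "0 \<le> r" "r \<le> 1" and a: "0 < a"
    and le: "(\<integral>\<^sup>+ x. ennreal (V x) \<partial>M) \<le> ennreal a"
  shows "(\<integral>\<^sup>+ x. ennreal (V x powr r) \<partial>M) \<le> ennreal (a powr r)"
proof -
  define c d where "c = a powr r * (1 - r)" and "d = a powr r * r / a"
  have cd: "0 \<le> c" "0 \<le> d" using r a by (auto simp: c_def d_def)
  have "(\<integral>\<^sup>+ x. ennreal (V x powr r) \<partial>M) \<le> (\<integral>\<^sup>+ x. ennreal c + ennreal d * ennreal (V x) \<partial>M)"
  proof (rule nn_integral_mono)
    fix x assume x: "x \<in> space M"
    have "ennreal (V x powr r) \<le> ennreal (c + d * V x)"
      using powr_le_tangent[OF a pos[OF x] r] unfolding c_def d_def by (intro ennreal_leI)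
    also have "\<dots> = ennreal c + ennreal d * ennreal (V x)"
      using cd less_imp_le[OF pos[OF x]] by (simp add: ennreal_plus ennreal_mult)
    finally show "ennreal (V x powr r) \<le> ennreal c + ennreal d * ennreal (V x)" .
  qed
  also have "\<dots> = ennreal c + ennreal d * (\<integral>\<^sup>+ x. ennreal (V x) \<partial>M)"
    using cd by (simp add: nn_integral_add nn_integral_cmult emeasure_space_1)
  also have "\<dots> \<le> ennreal c + ennreal d * ennreal a"
    by (intro add_left_mono mult_left_mono le) simp
  also have "\<dots> = ennreal (c + d * a)"
    using cd a by (simp add: ennreal_plus ennreal_mult)
  also have "c + d * a = a powr r"
    using a by (simp add: c_def d_def algebra_simps)
  finally show ?thesis .
qed

text \<open>In a mixture whose mean is at most \<open>B\<close>, a component of mean at least \<open>1\<close> uses up its weight. Applied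
to the two parts of \<open>P\<^sup>m\<close> in either order, this bounds both \<open>\<nu>(V)\<close> and the remainder mean of \<open>V\<close>.\<close>

lemma ennreal_le_of_weighted_sum_le:
  fixes a b :: ennreal and p q B :: real
  assumes le: "ennreal p * a + ennreal q * b \<le> ennreal B" and p: "0 < p" and q: "0 \<le> q" and b: "1 \<le> b"
    and B: "0 \<le> B"
  shows "a \<le> ennreal ((B - q) / p)"
proof -
  have "ennreal p * a \<le> ennreal B"
    using le by (rule order_trans[rotated]) simp
  then have "ennreal p * a < \<top>"
    by (rule le_less_trans) simp
  then have "a \<noteq> \<top>" using p by (auto simp: ennreal_mult_top)
  then obtain a' where a': "a = ennreal a'" "0 \<le> a'" by (cases a) auto
  have "ennreal (p * a' + q) = ennreal p * a + ennreal q * 1"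
    using p q a' by (simp add: ennreal_mult)
  also have "\<dots> \<le> ennreal p * a + ennreal q * b"
    by (intro add_left_mono mult_left_mono b) simp
  also have "\<dots> \<le> ennreal B" by (rule le)
  finally have "p * a' + q \<le> B"
    using B by simp
  with p show ?thesis unfolding a' by (intro ennreal_leI) (simp add: field_simps)
qed

section \<open>Arithmetic of the rate\<close>

lemma drift_B_1: "lam < 1 \<Longrightarrow> drift_B lam K (Suc 0) = K"
  by (simp add: drift_B_def)

text \<open>The constant \<open>B\<close> as a function of \<open>m\<close> solves the recursion of the means of \<open>V\<close> under one more step
of the drift inequality \<open>PV \<le> lam V + (K - lam)\<close>; it equals \<open>K\<close> at \<open>1\<close>, the bound on \<open>C\<close>.\<close>

lemma drift_B_Suc:
  assumes "lam < 1" shows "drift_B lam K (Suc k) = lam * drift_B lam K k + (K - lam)"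
  using assms by (simp add: drift_B_def field_simps)

lemma one_le_drift_B:
  assumes "0 < lam" "lam < 1" "1 \<le> K" shows "1 \<le> drift_B lam K m"
proof (induction m)
  case 0 then show ?case by (simp add: drift_B_def)
next
  case (Suc m)
  then have "lam * 1 \<le> lam * drift_B lam K m" using assms by (intro mult_left_mono) auto
  then show ?case using assms unfolding drift_B_Suc[OF assms(2)] by linarith
qed

text \<open>For \<open>\<epsilon> < 1\<close>, write the exponential in the definition of \<open>\<rho>\<close> as \<open>lam powr e\<close>. The maximum then says that
\<open>r = min 1 e\<close>, and \<open>r \<le> e\<close> is the logarithm of the last inequality, solved for \<open>r\<close>; this is where the
denominator in the definition of \<open>\<rho>\<close> comes from.\<close>

lemma drift_rate:
  fixes lam K \<epsilon> :: real and m :: nat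
  assumes lam: "0 < lam" "lam < 1" and K: "1 \<le> K" and m: "1 \<le> m" and \<epsilon>: "0 < \<epsilon>" "\<epsilon> \<le> 1"
  defines "\<rho> \<equiv> drift_rho lam K m \<epsilon>" and "r \<equiv> drift_r lam K m \<epsilon>"
  shows "0 < \<rho>" "\<rho> < 1" "0 < r" "r \<le> 1" "\<rho> = lam powr r"
    and "(1 - \<epsilon>) * ((drift_B lam K m - \<epsilon>) / (1 - \<epsilon>)) powr r \<le> \<rho> ^ m"
proof -
  have "0 < \<rho> \<and> \<rho> < 1 \<and> 0 < r \<and> r \<le> 1 \<and> \<rho> = lam powr r \<and>
    (1 - \<epsilon>) * ((drift_B lam K m - \<epsilon>) / (1 - \<epsilon>)) powr r \<le> \<rho> ^ m"
  proof (cases "\<epsilon> = 1")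
    case True
    then show ?thesis using lam by (auto simp: \<rho>_def r_def drift_rho_def drift_r_def)
  next
    case False
    with \<epsilon> have \<epsilon>1: "\<epsilon> < 1" by simp
    define b where "b = drift_B lam K m - \<epsilon>"
    define D where "D = - real m * ln lam + ln b - ln (1 - \<epsilon>)"
    define e where "e = - ln (1 - \<epsilon>) / D"
    have b: "1 - \<epsilon> \<le> b" using one_le_drift_B[OF lam K, of m] by (simp add: b_def)
    have b0: "0 < b" using b \<epsilon>1 by simp
    have lnlam: "ln lam < 0" using lam by simp
    have "0 < - real m * ln lam" using m lnlam by (simp add: mult_pos_neg)
    moreover have "ln (1 - \<epsilon>) \<le> ln b" using b \<epsilon>1 by simp
    ultimately have D: "0 < D" by (simp add: D_def)
    have e: "0 < e" using D \<epsilon> \<epsilon>1 by (simp add: e_def divide_neg_pos)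
    have \<rho>: "\<rho> = max lam (exp (e * ln lam))"
      using False by (simp add: \<rho>_def drift_rho_def e_def D_def b_def)
    have r: "r = ln \<rho> / ln lam"
      using False by (simp add: \<rho>_def r_def drift_r_def)
    have \<rho>0: "0 < \<rho>" and \<rho>1: "\<rho> < 1"
      using lam e lnlam by (auto simp: \<rho> max_def mult_pos_neg)
    have r1: "r \<le> 1"
    proof -
      have "ln lam \<le> ln \<rho>" using lam \<rho> by simp
      then show ?thesis using lnlam by (simp add: r divide_le_eq)
    qed
    have r0: "0 < r" using \<rho>0 \<rho>1 lnlam by (simp add: r divide_neg_neg)
    have re: "r \<le> e"
    proof -
      have "ln (exp (e * ln lam)) \<le> ln \<rho>" by (subst ln_le_cancel_iff) (auto simp: \<rho>0, simp add: \<rho>)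
      then show ?thesis using lnlam by (simp add: r divide_le_eq)
    qed
    have pow: "\<rho> = lam powr r" using lam lnlam \<rho>0 by (simp add: r powr_def)
    have "(1 - \<epsilon>) * (b / (1 - \<epsilon>)) powr r \<le> \<rho> ^ m"
    proof -
      have "r * D \<le> - ln (1 - \<epsilon>)" using re D by (simp add: e_def field_simps)
      then have "ln (1 - \<epsilon>) + r * (ln b - ln (1 - \<epsilon>)) \<le> real m * (r * ln lam)"
        by (simp add: D_def algebra_simps)
      then have "exp (ln (1 - \<epsilon>) + r * ln (b / (1 - \<epsilon>))) \<le> exp (real m * (r * ln lam))"
        using b0 \<epsilon>1 by (simp add: ln_div)
      then have "(1 - \<epsilon>) * (b / (1 - \<epsilon>)) powr r \<le> exp (real m * (r * ln lam))"
        using b0 \<epsilon>1 by (simp add: exp_add powr_def)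
      also have "exp (real m * (r * ln lam)) = \<rho> ^ m"
        using lam by (simp add: pow powr_def flip: exp_of_nat_mult)
      finally show ?thesis .
    qed
    with \<rho>0 \<rho>1 r0 r1 pow show ?thesis by (simp add: b_def)
  qed
  then show "0 < \<rho>" "\<rho> < 1" "0 < r" "r \<le> 1" "\<rho> = lam powr r"
    "(1 - \<epsilon>) * ((drift_B lam K m - \<epsilon>) / (1 - \<epsilon>)) powr r \<le> \<rho> ^ m" by auto
qed

section \<open>Markov chains given by the Ionescu-Tulcea construction\<close>

text \<open>The law of a time-homogeneous Markov chain with initial law \<open>I\<close> and kernel \<open>K\<close> is the special case of
the Ionescu-Tulcea construction in which each transition looks only at the last coordinate.\<close>

lemma Ionescu_Tulcea_markov:
  assumes I: "I \<in> space (prob_algebra S)" and K: "K \<in> S \<rightarrow>\<^sub>M prob_algebra S"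
  shows "Ionescu_Tulcea (\<lambda>k \<omega>. if k = 0 then I else K (\<omega> (k - 1))) (\<lambda>_. S)"
proof (rule Ionescu_Tulcea.intro)
  have I': "I \<in> space (subprob_algebra S)" "prob_space I"
    using I by (auto simp: space_prob_algebra space_subprob_algebra prob_space_imp_subprob_space)
  have K': "K \<in> S \<rightarrow>\<^sub>M subprob_algebra S" "\<And>s. s \<in> space S \<Longrightarrow> prob_space (K s)"
    using K measurable_space[OF K] by (auto simp: space_prob_algebra intro: measurable_prob_algebraD)
  show "(\<lambda>\<omega>. if i = 0 then I else K (\<omega> (i - 1))) \<in> (\<Pi>\<^sub>M j\<in>{0..<i}. S) \<rightarrow>\<^sub>M subprob_algebra S" for i :: nat
    using I' measurable_compose[OF measurable_component_singleton[of "i - 1" "{0..<i}" "\<lambda>_. S"] K'(1)]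
    by (cases "i = 0") auto
  fix i :: nat and \<omega> assume "\<omega> \<in> space (\<Pi>\<^sub>M j\<in>{0..<i}. S)"
  then show "prob_space (if i = 0 then I else K (\<omega> (i - 1)))"
    using I' K'(2) by (auto simp: space_PiM PiE_iff)
qed

text \<open>The expectation of a nonnegative supermartingale at a fixed index is at most the initial one.
Formulating it for functions of the current state only lets the proof work with
finite-dimensional laws: the marginal at \<open>k\<close> is that of the law of the first \<open>k + 1\<close> coordinates, and
removing the last transition lowers \<open>k\<close> by one.\<close>

lemma markov_supermartingale:
  fixes g :: "nat \<Rightarrow> 's \<Rightarrow> ennreal"
  assumes I: "I \<in> space (prob_algebra S)" and K: "K \<in> S \<rightarrow>\<^sub>M prob_algebra S"
    and g[measurable]: "\<And>k. g k \<in> borel_measurable S"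
    and step: "\<And>k s. s \<in> space S \<Longrightarrow> (\<integral>\<^sup>+ s'. g (Suc k) s' \<partial>K s) \<le> g k s"
  defines "L \<equiv> projective_family.lim UNIV
    (Ionescu_Tulcea.CI (\<lambda>k \<omega>. if k = 0 then I else K (\<omega> (k - 1))) (\<lambda>_. S)) (\<lambda>_. S)"
  shows "(\<integral>\<^sup>+ \<omega>. g k (\<omega> k) \<partial>L) \<le> (\<integral>\<^sup>+ s. g 0 s \<partial>I)"
proof -
  interpret IT: Ionescu_Tulcea "\<lambda>k \<omega>. if k = 0 then I else K (\<omega> (k - 1))" "\<lambda>_. S"
    using I K by (rule Ionescu_Tulcea_markov)
  let ?C = "\<lambda>n. IT.C 0 n (\<lambda>_. undefined)"
  have setsL: "sets L = sets (\<Pi>\<^sub>M i\<in>UNIV. S)"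
    unfolding L_def by (rule IT.PF.sets_lim)
  have Cprob: "prob_space (?C n)" for n
    by (rule IT.prob_space_C) simp
  have setsC: "sets (?C n) = sets (\<Pi>\<^sub>M i\<in>{0..<n}. S)" for n
    using IT.sets_C[of "\<lambda>_. undefined" 0 n] by simp
  have gk: "(\<lambda>\<omega>. g k (\<omega> k)) \<in> borel_measurable (\<Pi>\<^sub>M i\<in>J. S)" if "k \<in> J" for k J
    using that by measurable
  \<comment> \<open>Integrating out the last coordinate replaces it by one application of the kernel.\<close>
  have peel: "(\<integral>\<^sup>+ \<omega>. g k (\<omega> k) \<partial>?C (Suc k)) =
      (\<integral>\<^sup>+ \<omega>. \<integral>\<^sup>+ s. g k s \<partial>(if k = 0 then I else K (\<omega> (k - 1))) \<partial>?C k)" for k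
  proof -
    have "(\<integral>\<^sup>+ \<omega>. g k (\<omega> k) \<partial>?C (Suc k)) = (\<integral>\<^sup>+ \<omega>. \<integral>\<^sup>+ \<omega>'. g k (\<omega>' k) \<partial>IT.eP k \<omega> \<partial>?C k)"
      by (simp, rule nn_integral_bind[where B="\<Pi>\<^sub>M i\<in>{0..<Suc k}. S"])
        (auto intro!: gk simp: measurable_cong_sets[OF setsC refl])
    also have "\<dots> = (\<integral>\<^sup>+ \<omega>. \<integral>\<^sup>+ s. g k s \<partial>(if k = 0 then I else K (\<omega> (k - 1))) \<partial>?C k)"
    proof (rule nn_integral_cong)
      fix \<omega> assume "\<omega> \<in> space (?C k)"
      then have "\<omega> \<in> space (\<Pi>\<^sub>M i\<in>{0..<k}. S)"
        using sets_eq_imp_space_eq[OF setsC] by auto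
      from IT.nn_integral_eP[OF this, of "\<lambda>\<omega>. g k (\<omega> k)"]
      show "(\<integral>\<^sup>+ \<omega>'. g k (\<omega>' k) \<partial>IT.eP k \<omega>) = (\<integral>\<^sup>+ s. g k s \<partial>(if k = 0 then I else K (\<omega> (k - 1))))"
        by (auto intro!: gk)
    qed
    finally show ?thesis .
  qed
  have bound: "(\<integral>\<^sup>+ \<omega>. g k (\<omega> k) \<partial>?C (Suc k)) \<le> (\<integral>\<^sup>+ s. g 0 s \<partial>I)"
  proof (induction k)
    case 0
    have "(\<integral>\<^sup>+ \<omega>. g 0 (\<omega> 0) \<partial>?C (Suc 0)) = (\<integral>\<^sup>+ \<omega>. (\<integral>\<^sup>+ s. g 0 s \<partial>I) \<partial>?C 0)"
      by (subst peel) simp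
    also have "\<dots> \<le> (\<integral>\<^sup>+ s. g 0 s \<partial>I)"
      using prob_space.emeasure_space_1[OF Cprob[of 0]] by (simp del: IT.C.simps)
    finally show ?case .
  next
    case (Suc k)
    have "(\<integral>\<^sup>+ \<omega>. g (Suc k) (\<omega> (Suc k)) \<partial>?C (Suc (Suc k))) =
        (\<integral>\<^sup>+ \<omega>. \<integral>\<^sup>+ s. g (Suc k) s \<partial>K (\<omega> k) \<partial>?C (Suc k))"
      by (subst peel) (simp del: IT.C.simps)
    also have "\<dots> \<le> (\<integral>\<^sup>+ \<omega>. g k (\<omega> k) \<partial>?C (Suc k))"
      by (intro nn_integral_mono step)
        (auto simp: sets_eq_imp_space_eq[OF setsC] space_PiM PiE_iff simp del: IT.C.simps)
    finally show ?case using Suc by (rule order_trans)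
  qed
  have "(\<integral>\<^sup>+ \<omega>. g k (\<omega> k) \<partial>L) = (\<integral>\<^sup>+ \<omega>. g k (restrict \<omega> {k} k) \<partial>L)"
    by simp
  also have "\<dots> = (\<integral>\<^sup>+ \<omega>. g k (\<omega> k) \<partial>distr L (\<Pi>\<^sub>M i\<in>{k}. S) (\<lambda>\<omega>. restrict \<omega> {k}))"
    by (subst nn_integral_distr)
      (auto intro!: gk measurable_restrict measurable_component_singleton
        simp: measurable_cong_sets[OF setsL refl])
  also have "distr L (\<Pi>\<^sub>M i\<in>{k}. S) (\<lambda>\<omega>. restrict \<omega> {k}) = IT.CI {k}"
    unfolding L_def by (rule IT.distr_lim) simp
  also have "(\<integral>\<^sup>+ \<omega>. g k (\<omega> k) \<partial>IT.CI {k}) = (\<integral>\<^sup>+ \<omega>. g k (\<omega> k) \<partial>?C (IT.up_to {k}))"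
    unfolding IT.CI_def
    by (subst nn_integral_distr)
      (auto intro!: gk measurable_restrict measurable_component_singleton IT.up_to_less
        simp: measurable_cong_sets[OF setsC refl])
  also have "IT.up_to {k} = Suc k"
    by (rule antisym) (auto simp: IT.up_to_iff Suc_le_eq intro: IT.up_to_less)
  finally show ?thesis using bound by simp
qed

lemma markov_run_prob_space:
  assumes I: "I \<in> space (prob_algebra S)" and K: "K \<in> S \<rightarrow>\<^sub>M prob_algebra S"
  defines "L \<equiv> projective_family.lim UNIV
    (Ionescu_Tulcea.CI (\<lambda>k \<omega>. if k = 0 then I else K (\<omega> (k - 1))) (\<lambda>_. S)) (\<lambda>_. S)"
  shows "prob_space L" "sets L = sets (\<Pi>\<^sub>M i\<in>UNIV. S)"
proof -
  interpret IT: Ionescu_Tulcea "\<lambda>k \<omega>. if k = 0 then I else K (\<omega> (k - 1))" "\<lambda>_. S"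
    using I K by (rule Ionescu_Tulcea_markov)
  show setsL: "sets L = sets (\<Pi>\<^sub>M i\<in>UNIV. S)"
    unfolding L_def by (rule IT.PF.sets_lim)
  have "distr L (\<Pi>\<^sub>M i\<in>{}. S) (\<lambda>\<omega>. restrict \<omega> {}) = IT.CI {}"
    unfolding L_def by (rule IT.distr_lim) simp
  moreover have "prob_space (IT.CI {})" by (rule IT.PF.prob_space_P) auto
  ultimately show "prob_space L"
    by (intro prob_space_distrD[of "\<lambda>\<omega>. restrict \<omega> {}" L "\<Pi>\<^sub>M i\<in>{}. S"])
      (auto simp: measurable_cong_sets[OF setsL refl] intro!: measurable_restrict)
qed

section \<open>Powers of a kernel\<close>

lemma measurable_kernel_power:
  assumes P: "P \<in> M \<rightarrow>\<^sub>M prob_algebra M"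
  shows "kernel_power M P k \<in> M \<rightarrow>\<^sub>M prob_algebra M"
proof (induction k)
  case 0
  have "kernel_power M P 0 = return M" by (rule ext) simp
  then show ?case by simp
next
  case (Suc k)
  have "kernel_power M P (Suc k) = (\<lambda>x. kernel_power M P k x \<bind> P)" by (rule ext) simp
  with measurable_bind_prob_space[OF Suc P] show ?case by simp
qed

lemma nn_integral_kernel_power_Suc:
  assumes P: "P \<in> M \<rightarrow>\<^sub>M prob_algebra M" and x: "x \<in> space M" and f: "f \<in> borel_measurable M"
  shows "(\<integral>\<^sup>+ y. f y \<partial>kernel_power M P (Suc k) x) = (\<integral>\<^sup>+ y. \<integral>\<^sup>+ z. f z \<partial>P y \<partial>kernel_power M P k x)"
proof -
  have "sets (kernel_power M P k x) = sets M"
    using measurable_space[OF measurable_kernel_power[OF P] x] by (simp add: space_prob_algebra)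
  then have "P \<in> kernel_power M P k x \<rightarrow>\<^sub>M subprob_algebra M"
    using measurable_prob_algebraD[OF P] by (simp cong: measurable_cong_sets)
  from nn_integral_bind[OF f this] show ?thesis by simp
qed

section \<open>Geometric drift towards a small set\<close>

locale regeneration =
  fixes M :: "'a measure" and P :: "'a \<Rightarrow> 'a measure" and C :: "'a set"
    and V :: "'a \<Rightarrow> real" and lam K \<epsilon> :: real and m :: nat and \<nu> :: "'a measure"
    and Q :: "'a \<times> 'a \<Rightarrow> (nat \<Rightarrow> 'a) measure"
  assumes kernel: "P \<in> M \<rightarrow>\<^sub>M prob_algebra M"
    and drift: "drift_function M P C V lam K"
    and small: "small_set M P C m \<epsilon> \<nu>"
    and bridge: "bridge_kernel M P C m Q"
begin

lemma measurable_V[measurable]: "V \<in> borel_measurable M"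
  and V_ge_1: "x \<in> space M \<Longrightarrow> 1 \<le> V x"
  and lam: "0 < lam" "lam < 1"
  and drift_outside: "x \<in> space M \<Longrightarrow> x \<notin> C \<Longrightarrow> (\<integral>\<^sup>+ y. ennreal (V y) \<partial>P x) \<le> ennreal (lam * V x)"
  and drift_inside: "x \<in> C \<Longrightarrow> (\<integral>\<^sup>+ y. ennreal (V y) \<partial>P x) \<le> ennreal K"
  using drift by (auto simp: drift_function_def)

lemma sets_C[measurable]: "C \<in> sets M"
  and m: "1 \<le> m"
  and eps_pos: "0 < \<epsilon>"
  and nu: "\<nu> \<in> space (prob_algebra M)"
  and minorization: "x \<in> C \<Longrightarrow> S \<in> sets M \<Longrightarrow>
    ennreal \<epsilon> * emeasure \<nu> S \<le> emeasure (kernel_power M P m x) S"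
  using small by (auto simp: small_set_def)

lemma C_space: "x \<in> C \<Longrightarrow> x \<in> space M"
  using sets.sets_into_space[OF sets_C] by auto

lemma kernel_in: "x \<in> space M \<Longrightarrow> P x \<in> space (prob_algebra M)"
  using measurable_space[OF kernel] by auto

lemma kernel_power_in: "x \<in> space M \<Longrightarrow> kernel_power M P k x \<in> space (prob_algebra M)"
  using measurable_space[OF measurable_kernel_power[OF kernel]] by auto

lemma law_props:
  assumes "N \<in> space (prob_algebra M)"
  shows "sets N = sets M" "space N = space M" "prob_space N"
  using assms sets_eq_imp_space_eq by (auto simp: space_prob_algebra)

lemma nn_integral_law_const:
  assumes "N \<in> space (prob_algebra M)" shows "(\<integral>\<^sup>+ y. c \<partial>N) = c"
  using prob_space.emeasure_space_1[OF law_props(3)[OF assms]] by simp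

lemma one_le_law_V:
  assumes N: "N \<in> space (prob_algebra M)" shows "1 \<le> (\<integral>\<^sup>+ y. ennreal (V y) \<partial>N)"
proof -
  have "(\<integral>\<^sup>+ y. 1 \<partial>N) \<le> (\<integral>\<^sup>+ y. ennreal (V y) \<partial>N)"
    using V_ge_1 law_props[OF N] by (intro nn_integral_mono) simp
  then show ?thesis unfolding nn_integral_law_const[OF N] .
qed

text \<open>If \<open>C\<close> were empty, \<open>V\<close> would contract at every step, so that the means of \<open>V\<close> under \<open>P\<^sup>k\<close> would tend
to \<open>0\<close>, against \<open>V \<ge> 1\<close>. A point of \<open>C\<close> is what forces \<open>K \<ge> 1\<close> and \<open>\<epsilon> \<le> 1\<close> below.\<close>

lemma C_nonempty: "C \<noteq> {}"
proof
  assume C: "C = {}"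
  obtain x where x: "x \<in> space M"
    using prob_space.not_empty[OF law_props(3)[OF nu]] law_props(2)[OF nu] by auto
  have bound: "(\<integral>\<^sup>+ y. ennreal (V y) \<partial>kernel_power M P k x) \<le> ennreal (lam ^ k * V x)" for k
  proof (induction k)
    case 0
    then show ?case using x by (simp add: nn_integral_return)
  next
    case (Suc k)
    have "(\<integral>\<^sup>+ y. ennreal (V y) \<partial>kernel_power M P (Suc k) x)
        \<le> (\<integral>\<^sup>+ y. ennreal lam * ennreal (V y) \<partial>kernel_power M P k x)"
      unfolding nn_integral_kernel_power_Suc[OF kernel x measurable_compose[OF measurable_V measurable_ennreal]]
    proof (rule nn_integral_mono)
      fix y assume "y \<in> space (kernel_power M P k x)"
      then have "y \<in> space M" using law_props(2)[OF kernel_power_in[OF x]] by simp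
      with drift_outside[of y] C lam show "(\<integral>\<^sup>+ z. ennreal (V z) \<partial>P y) \<le> ennreal lam * ennreal (V y)"
        by (simp add: ennreal_mult')
    qed
    also have "\<dots> = ennreal lam * (\<integral>\<^sup>+ y. ennreal (V y) \<partial>kernel_power M P k x)"
      by (rule nn_integral_cmult) (simp cong: measurable_cong_sets add: law_props(1)[OF kernel_power_in[OF x]])
    also have "\<dots> \<le> ennreal lam * ennreal (lam ^ k * V x)"
      by (intro mult_left_mono Suc) simp
    also have "\<dots> = ennreal (lam ^ Suc k * V x)"
      using lam by (simp add: mult.assoc flip: ennreal_mult')
    finally show ?case .
  qed
  obtain k where k: "lam ^ k < 1 / V x"
    using real_arch_pow_inv[of "1 / V x" lam] lam V_ge_1[OF x] by auto
  have "ennreal 1 \<le> ennreal (lam ^ k * V x)"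
    using order_trans[OF one_le_law_V[OF kernel_power_in[OF x]] bound] by simp
  then have "1 \<le> lam ^ k * V x"
    using lam V_ge_1[OF x] by (subst (asm) ennreal_le_iff) auto
  with k V_ge_1[OF x] show False by (simp add: field_simps)
qed

lemma K_ge_1: "1 \<le> K"
proof -
  obtain x where x: "x \<in> C" using C_nonempty by auto
  have "ennreal 1 \<le> ennreal K"
    using order_trans[OF one_le_law_V[OF kernel_in[OF C_space[OF x]]] drift_inside[OF x]] by simp
  then show ?thesis by (subst (asm) ennreal_le_iff2) auto
qed

lemma eps_le_1: "\<epsilon> \<le> 1"
proof -
  obtain x where x: "x \<in> C" using C_nonempty by auto
  have "ennreal \<epsilon> * 1 \<le> 1"
    using minorization[OF x sets.top] in_space_prob_algebra[OF nu]
      in_space_prob_algebra[OF kernel_power_in[OF C_space[OF x], of m]] by simp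
  then show ?thesis by simp
qed

abbreviation "B \<equiv> drift_B lam K m"
abbreviation "\<rho> \<equiv> drift_rho lam K m \<epsilon>"
abbreviation "r \<equiv> drift_r lam K m \<epsilon>"

lemmas rate = drift_rate[OF lam K_ge_1 m eps_pos eps_le_1]
lemmas B_ge_1 = one_le_drift_B[OF lam K_ge_1, of m]

text \<open>The two cases of the drift condition in one affine inequality, which can be iterated. On \<open>C\<close> it holds
because \<open>lam * V x \<ge> lam\<close>.\<close>

lemma drift_everywhere:
  assumes x: "x \<in> space M"
  shows "(\<integral>\<^sup>+ y. ennreal (V y) \<partial>P x) \<le> ennreal lam * ennreal (V x) + ennreal (K - lam)"
proof -
  have eq: "ennreal (lam * V x + (K - lam)) = ennreal lam * ennreal (V x) + ennreal (K - lam)"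
    using lam K_ge_1 V_ge_1[OF x] by (simp add: ennreal_mult)
  show ?thesis
  proof (cases "x \<in> C")
    case True
    have "lam * 1 \<le> lam * V x" using lam V_ge_1[OF x] by (intro mult_left_mono) auto
    then have "ennreal K \<le> ennreal (lam * V x + (K - lam))" by (intro ennreal_leI) simp
    with drift_inside[OF True] show ?thesis unfolding eq by (rule order_trans)
  next
    case False
    have "ennreal (lam * V x) \<le> ennreal (lam * V x + (K - lam))"
      using lam K_ge_1 by (intro ennreal_leI) simp
    with drift_outside[OF x False] show ?thesis unfolding eq by (rule order_trans)
  qed
qed

lemma kernel_power_V_le:
  assumes x: "x \<in> C"
  shows "(\<integral>\<^sup>+ y. ennreal (V y) \<partial>kernel_power M P (Suc k) x) \<le> ennreal (drift_B lam K (Suc k))"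
proof (induction k)
  case 0
  have "(\<integral>\<^sup>+ y. ennreal (V y) \<partial>kernel_power M P (Suc 0) x) = (\<integral>\<^sup>+ y. ennreal (V y) \<partial>P x)"
    using C_space[OF x] measurable_prob_algebraD[OF kernel] by (simp add: bind_return)
  with drift_inside[OF x] lam show ?case by (simp add: drift_B_1 del: kernel_power.simps)
next
  case (Suc k)
  note xM = C_space[OF x]
  let ?N = "kernel_power M P (Suc k) x"
  have meas: "(\<lambda>y. ennreal (V y)) \<in> borel_measurable ?N"
    by (simp cong: measurable_cong_sets add: law_props(1)[OF kernel_power_in[OF xM]] del: kernel_power.simps)
  have "(\<integral>\<^sup>+ y. ennreal (V y) \<partial>kernel_power M P (Suc (Suc k)) x)
      \<le> (\<integral>\<^sup>+ y. ennreal lam * ennreal (V y) + ennreal (K - lam) \<partial>?N)"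
    unfolding nn_integral_kernel_power_Suc[OF kernel xM measurable_compose[OF measurable_V measurable_ennreal], of "Suc k"]
    by (intro nn_integral_mono drift_everywhere)
      (simp add: law_props(2)[OF kernel_power_in[OF xM]] del: kernel_power.simps)
  also have "\<dots> = ennreal lam * (\<integral>\<^sup>+ y. ennreal (V y) \<partial>?N) + ennreal (K - lam)"
    using meas nn_integral_law_const[OF kernel_power_in[OF xM]]
    by (simp add: nn_integral_add nn_integral_cmult del: kernel_power.simps)
  also have "\<dots> \<le> ennreal lam * ennreal (drift_B lam K (Suc k)) + ennreal (K - lam)"
    by (intro add_right_mono mult_left_mono Suc) simp
  also have "\<dots> = ennreal (drift_B lam K (Suc (Suc k)))"
    using lam K_ge_1 one_le_drift_B[OF lam K_ge_1, of "Suc k"]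
    by (simp add: drift_B_Suc[OF lam(2), of K "Suc k"] ennreal_mult ennreal_plus)
  finally show ?case .
qed

section \<open>Splitting off the minorizing measure\<close>

text \<open>The law after tails, extended to a probability kernel on the whole space and for every \<open>\<epsilon>\<close>. The default
\<open>\<nu>\<close> stands outside \<open>C\<close>, where the minorization may fail, and for \<open>\<epsilon> = 1\<close>, where the remainder
is zero and tails has probability zero.\<close>

definition tail_law :: "'a \<Rightarrow> 'a measure" where
  "tail_law x = (if x \<in> C \<and> \<epsilon> < 1 then remainder_law M P m \<epsilon> \<nu> x else \<nu>)"

lemma emeasure_remainder_law:
  assumes x: "x \<in> C" and A: "A \<in> sets M"
  shows "emeasure (remainder_law M P m \<epsilon> \<nu> x) A =
    ennreal (1 / (1 - \<epsilon>)) * (emeasure (kernel_power M P m x) A - ennreal \<epsilon> * emeasure \<nu> A)"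
proof -
  note L = law_props[OF kernel_power_in[OF C_space[OF x]], of m] law_props[OF nu]
  interpret N: prob_space \<nu> by fact
  have "finite_measure (scale_measure (ennreal \<epsilon>) \<nu>)"
    by standard (simp add: ennreal_mult_eq_top_iff space_scale_measure)
  then have "emeasure (diff_measure (kernel_power M P m x) (scale_measure (ennreal \<epsilon>) \<nu>)) A =
      emeasure (kernel_power M P m x) A - emeasure (scale_measure (ennreal \<epsilon>) \<nu>) A"
    using L A minorization[OF x]
    by (intro emeasure_diff_measure) (auto simp: prob_space_def)
  then show ?thesis by (simp add: remainder_law_def)
qed

lemma sets_remainder_law: "x \<in> C \<Longrightarrow> sets (remainder_law M P m \<epsilon> \<nu> x) = sets M"
  using law_props(1)[OF kernel_power_in[OF C_space]] by (simp add: remainder_law_def)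

lemma measurable_tail_law: "tail_law \<in> M \<rightarrow>\<^sub>M prob_algebra M"
proof (rule measurable_prob_algebraI)
  have prob: "prob_space (tail_law x)" and sets: "sets (tail_law x) = sets M" for x
  proof -
    show sets: "sets (tail_law x) = sets M"
      using sets_remainder_law law_props(1)[OF nu] by (simp add: tail_law_def)
    show "prob_space (tail_law x)"
    proof (cases "x \<in> C \<and> \<epsilon> < 1")
      case True
      then have "emeasure (tail_law x) (space M) = ennreal (1 / (1 - \<epsilon>)) * (1 - ennreal \<epsilon>)"
        using emeasure_remainder_law[of x "space M"] in_space_prob_algebra[OF nu]
          in_space_prob_algebra[OF kernel_power_in[OF C_space[of x], of m]]
        by (simp add: tail_law_def)
      also have "\<dots> = 1"
        using True eps_pos by (simp add: ennreal_minus flip: ennreal_1 ennreal_mult)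
      finally show ?thesis using sets_eq_imp_space_eq[OF sets] by (intro prob_spaceI) simp
    next
      case False
      then show ?thesis unfolding tail_law_def using law_props(3)[OF nu] by auto
    qed
  qed
  show "prob_space (tail_law x)" if "x \<in> space M" for x by (rule prob)
  show "tail_law \<in> M \<rightarrow>\<^sub>M subprob_algebra M"
  proof (rule measurable_subprob_algebra)
    fix A assume A[measurable]: "A \<in> sets M"
    have [measurable]: "kernel_power M P m \<in> M \<rightarrow>\<^sub>M subprob_algebra M"
      by (rule measurable_prob_algebraD[OF measurable_kernel_power[OF kernel]])
    have "emeasure (tail_law x) A = (if x \<in> C \<and> \<epsilon> < 1
        then ennreal (1 / (1 - \<epsilon>)) * (emeasure (kernel_power M P m x) A - ennreal \<epsilon> * emeasure \<nu> A)
        else emeasure \<nu> A)" for x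
      using emeasure_remainder_law A by (simp add: tail_law_def)
    then show "(\<lambda>x. emeasure (tail_law x) A) \<in> borel_measurable M" by simp
  qed (auto simp: sets prob intro: prob_space_imp_subprob_space)
qed

lemma tail_law_in: "x \<in> space M \<Longrightarrow> tail_law x \<in> space (prob_algebra M)"
  using measurable_space[OF measurable_tail_law] by auto

text \<open>For \<open>\<epsilon> = 1\<close> the remainder vanishes: a probability measure that dominates the probability measure \<open>\<nu>\<close>
equals it.\<close>

lemma emeasure_kernel_power_split:
  assumes x: "x \<in> C" and A: "A \<in> sets M"
  shows "emeasure (kernel_power M P m x) A =
    ennreal \<epsilon> * emeasure \<nu> A + ennreal (1 - \<epsilon>) * emeasure (tail_law x) A"
proof (cases "\<epsilon> < 1")
  case True
  then have "ennreal (1 - \<epsilon>) * emeasure (tail_law x) A =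
      (ennreal (1 - \<epsilon>) * ennreal (1 / (1 - \<epsilon>))) *
      (emeasure (kernel_power M P m x) A - ennreal \<epsilon> * emeasure \<nu> A)"
    using x by (simp add: tail_law_def emeasure_remainder_law[OF x A] mult.assoc)
  also have "ennreal (1 - \<epsilon>) * ennreal (1 / (1 - \<epsilon>)) = 1"
    using True by (simp flip: ennreal_mult)
  finally show ?thesis
    using minorization[OF x A] by (simp add: add_diff_inverse_ennreal)
next
  case False
  with eps_le_1 have eps: "\<epsilon> = 1" by simp
  note L = law_props[OF kernel_power_in[OF C_space[OF x]], of m] law_props[OF nu]
  interpret N: prob_space \<nu> by fact
  interpret R: prob_space "kernel_power M P m x" by fact
  have le: "measure \<nu> S \<le> measure (kernel_power M P m x) S" if "S \<in> sets M" for S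
    using minorization[OF x that] by (simp add: eps N.emeasure_eq_measure R.emeasure_eq_measure)
  have "measure (kernel_power M P m x) A = measure \<nu> A"
    using le[OF A] le[OF sets.compl_sets[OF A]] A N.prob_compl[of A] R.prob_compl[of A] L
    by (intro antisym) auto
  then show ?thesis by (simp add: eps N.emeasure_eq_measure R.emeasure_eq_measure)
qed

text \<open>The decomposition carries over from sets to integrals because it says that \<open>P\<^sup>m(x, \<cdot>)\<close> is the law of
a sample from \<open>\<nu>\<close> or from the tail law chosen by an \<open>\<epsilon>\<close>-coin.\<close>

lemma nn_integral_kernel_power_split:
  assumes x: "x \<in> C" and f: "f \<in> borel_measurable M"
  shows "(\<integral>\<^sup>+ y. f y \<partial>kernel_power M P m x) =
    ennreal \<epsilon> * (\<integral>\<^sup>+ y. f y \<partial>\<nu>) + ennreal (1 - \<epsilon>) * (\<integral>\<^sup>+ y. f y \<partial>tail_law x)"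
proof -
  let ?F = "\<lambda>h. if h then \<nu> else tail_law x"
  note xM = C_space[OF x]
  have F: "?F \<in> measure_pmf (bernoulli_pmf \<epsilon>) \<rightarrow>\<^sub>M prob_algebra M"
    using nu tail_law_in[OF xM] by (simp add: measurable_pmf_measure1)
  have F': "?F \<in> measure_pmf (bernoulli_pmf \<epsilon>) \<rightarrow>\<^sub>M subprob_algebra M"
    by (rule measurable_prob_algebraD[OF F])
  have eps: "0 \<le> \<epsilon>" "\<epsilon> \<le> 1" using eps_pos eps_le_1 by auto
  have "kernel_power M P m x = measure_pmf (bernoulli_pmf \<epsilon>) \<bind> ?F"
  proof (rule measure_eqI)
    have "sets (measure_pmf (bernoulli_pmf \<epsilon>) \<bind> ?F) = sets M"
      by (rule sets_bind) (auto simp: law_props(1)[OF nu] law_props(1)[OF tail_law_in[OF xM]])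
    then show "sets (kernel_power M P m x) = sets (measure_pmf (bernoulli_pmf \<epsilon>) \<bind> ?F)"
      using law_props(1)[OF kernel_power_in[OF xM]] by simp
  next
    fix A assume "A \<in> sets (kernel_power M P m x)"
    then have A: "A \<in> sets M" using law_props(1)[OF kernel_power_in[OF xM]] by simp
    then show "emeasure (kernel_power M P m x) A = emeasure (measure_pmf (bernoulli_pmf \<epsilon>) \<bind> ?F) A"
      using eps by (subst emeasure_bind[OF _ F']) (auto simp: emeasure_kernel_power_split[OF x] mult.commute)
  qed
  then show ?thesis
    using eps by (simp add: nn_integral_bind[OF f F'] mult.commute)
qed

lemma weighted_V_le:
  assumes x: "x \<in> C"
  shows "ennreal \<epsilon> * (\<integral>\<^sup>+ y. ennreal (V y) \<partial>\<nu>) + ennreal (1 - \<epsilon>) * (\<integral>\<^sup>+ y. ennreal (V y) \<partial>tail_law x)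
    \<le> ennreal B"
  using kernel_power_V_le[OF x, of "m - 1"] m
  by (subst nn_integral_kernel_power_split[OF x, symmetric]) (auto simp del: kernel_power.simps)

lemma nu_V_le: "(\<integral>\<^sup>+ y. ennreal (V y) \<partial>\<nu>) \<le> ennreal ((B - (1 - \<epsilon>)) / \<epsilon>)"
proof -
  obtain x where x: "x \<in> C" using C_nonempty by auto
  show ?thesis
    by (rule ennreal_le_of_weighted_sum_le[OF weighted_V_le[OF x] eps_pos _ one_le_law_V[OF tail_law_in[OF C_space[OF x]]]])
      (use eps_le_1 B_ge_1 in auto)
qed

lemma tail_V_le:
  assumes x: "x \<in> C" and eps: "\<epsilon> < 1"
  shows "(\<integral>\<^sup>+ y. ennreal (V y) \<partial>tail_law x) \<le> ennreal ((B - \<epsilon>) / (1 - \<epsilon>))"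
  by (rule ennreal_le_of_weighted_sum_le[OF _ _ _ one_le_law_V[OF nu]])
    (use weighted_V_le[OF x] eps eps_pos B_ge_1 in \<open>auto simp: add.commute\<close>)

section \<open>Drift of a concave power\<close>

lemma law_V_powr_le:
  assumes N: "N \<in> space (prob_algebra M)" and a: "0 < a"
    and le: "(\<integral>\<^sup>+ y. ennreal (V y) \<partial>N) \<le> ennreal a"
  shows "(\<integral>\<^sup>+ y. ennreal (V y powr r) \<partial>N) \<le> ennreal (a powr r)"
proof -
  interpret prob_space N by (rule law_props(3)[OF N])
  show ?thesis
  proof (rule nn_integral_powr_le[OF _ _ _ _ a le])
    show "V \<in> borel_measurable N"
      using measurable_V by (simp cong: measurable_cong_sets add: law_props(1)[OF N])
    show "0 < V y" if "y \<in> space N" for y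
      using V_ge_1[of y] that law_props(2)[OF N] by simp
  qed (use rate in auto)
qed

lemma outside_V_powr_le:
  assumes x: "x \<in> space M" "x \<notin> C"
  shows "(\<integral>\<^sup>+ y. ennreal (V y powr r) \<partial>P x) \<le> ennreal (\<rho> * V x powr r)"
proof -
  have "(\<integral>\<^sup>+ y. ennreal (V y powr r) \<partial>P x) \<le> ennreal ((lam * V x) powr r)"
    using lam V_ge_1[OF x(1)] drift_outside[OF x] by (intro law_V_powr_le kernel_in x) auto
  also have "(lam * V x) powr r = \<rho> * V x powr r"
    using lam V_ge_1[OF x(1)] rate(5) by (simp add: powr_mult)
  finally show ?thesis .
qed

text \<open>The mean of \<open>V\<^sup>r\<close> on the event that the coin shows tails decays as fast as along \<open>m\<close> steps outside \<open>C\<close>.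
This is the inequality for which the rate was designed.\<close>

lemma tail_V_powr_le:
  assumes x: "x \<in> C"
  shows "ennreal (1 - \<epsilon>) * (\<integral>\<^sup>+ y. ennreal (V y powr r) \<partial>tail_law x) \<le> ennreal (\<rho> ^ m)"
proof (cases "\<epsilon> < 1")
  case True
  have "(\<integral>\<^sup>+ y. ennreal (V y powr r) \<partial>tail_law x) \<le> ennreal (((B - \<epsilon>) / (1 - \<epsilon>)) powr r)"
    using True B_ge_1 by (intro law_V_powr_le tail_law_in tail_V_le C_space x) auto
  then have "ennreal (1 - \<epsilon>) * (\<integral>\<^sup>+ y. ennreal (V y powr r) \<partial>tail_law x)
      \<le> ennreal (1 - \<epsilon>) * ennreal (((B - \<epsilon>) / (1 - \<epsilon>)) powr r)"
    by (rule mult_left_mono) simp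
  also have "\<dots> = ennreal ((1 - \<epsilon>) * ((B - \<epsilon>) / (1 - \<epsilon>)) powr r)"
    using True by (simp add: ennreal_mult)
  also have "\<dots> \<le> ennreal (\<rho> ^ m)"
    by (intro ennreal_leI rate(6))
  finally show ?thesis .
next
  case False
  then show ?thesis using eps_le_1 by (simp add: ennreal_neg)
qed

end

section \<open>Laws of the rounds\<close>

text \<open>The clock and the recorded value range over countable sets, so measurability has to be checked only
in the path.\<close>

lemma measurable_state_space_split:
  assumes "\<And>n \<tau>. (\<lambda>x. f n x \<tau>) \<in> (\<Pi>\<^sub>M i\<in>UNIV. M) \<rightarrow>\<^sub>M N"
  shows "(\<lambda>(n, x, \<tau>). f n x \<tau>) \<in> state_space M \<rightarrow>\<^sub>M N"
proof -
  have "(\<lambda>s. f (fst s) (fst (snd s)) (snd (snd s))) \<in> state_space M \<rightarrow>\<^sub>M N"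
  proof (rule measurable_compose_countable[where f="\<lambda>n s. f n (fst (snd s)) (snd (snd s))" and g=fst])
    fix n :: nat
    show "(\<lambda>s. f n (fst (snd s)) (snd (snd s))) \<in> state_space M \<rightarrow>\<^sub>M N"
    proof (rule measurable_compose_countable[where f="\<lambda>\<tau> s. f n (fst (snd s)) \<tau>" and g="\<lambda>s. snd (snd s)"])
      fix \<tau> :: enat
      show "(\<lambda>s. f n (fst (snd s)) \<tau>) \<in> state_space M \<rightarrow>\<^sub>M N"
        unfolding state_space_def by (rule measurable_compose[OF _ assms]) measurable
    qed (simp add: state_space_def)
  qed (simp add: state_space_def)
  then show ?thesis by (simp add: split_beta')
qed

lemma space_state_space: "(n, x, \<tau>) \<in> space (state_space M) \<longleftrightarrow> (\<forall>k. x k \<in> space M)"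
  by (auto simp: state_space_def space_pair_measure space_PiM PiE_iff)

context regeneration
begin

abbreviation "S \<equiv> state_space M"
abbreviation "paths \<equiv> (\<Pi>\<^sub>M i\<in>(UNIV :: nat set). M)"

lemma measurable_Q: "Q \<in> M \<Otimes>\<^sub>M M \<rightarrow>\<^sub>M prob_algebra (\<Pi>\<^sub>M i\<in>{1..<m}. M)"
  using bridge by (simp add: bridge_kernel_def)

definition block :: "nat \<Rightarrow> bool \<Rightarrow> (nat \<Rightarrow> 'a) \<Rightarrow> 'a \<Rightarrow> (nat \<Rightarrow> 'a) \<Rightarrow> 'a prog_state" where
  "block n heads x y z =
    (n + m, (\<lambda>k. if n < k \<and> k < n + m then z (k - n) else if k = n + m then y else x k),
     if heads then enat (n + m) else \<infinity>)"

lemma measurable_block: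
  "(\<lambda>((x, y), z). block n heads x y z) \<in> (paths \<Otimes>\<^sub>M M) \<Otimes>\<^sub>M (\<Pi>\<^sub>M i\<in>{1..<m}. M) \<rightarrow>\<^sub>M S"
proof -
  let ?D = "(paths \<Otimes>\<^sub>M M) \<Otimes>\<^sub>M (\<Pi>\<^sub>M i\<in>{1..<m}. M)"
  have "(\<lambda>w k. if n < k \<and> k < n + m then snd w (k - n) else if k = n + m then snd (fst w) else fst (fst w) k)
      \<in> ?D \<rightarrow>\<^sub>M paths" (is "(\<lambda>w k. ?f k w) \<in> _")
  proof (rule measurable_PiM_single')
    show f: "?f k \<in> ?D \<rightarrow>\<^sub>M M" for k
    proof (cases "n < k \<and> k < n + m")
      case True
      then have "k - n \<in> {1..<m}" by auto
      then have "(\<lambda>w. snd w (k - n)) \<in> ?D \<rightarrow>\<^sub>M M" by measurable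
      with True show ?thesis by simp
    next
      case False
      have "(\<lambda>w. if k = n + m then snd (fst w) else fst (fst w) k) \<in> ?D \<rightarrow>\<^sub>M M"
        by (cases "k = n + m") simp_all
      with False show ?thesis by (simp only: if_False)
    qed
    show "(\<lambda>w k. ?f k w) \<in> space ?D \<rightarrow> (\<Pi>\<^sub>E k\<in>UNIV. space M)"
      using measurable_space[OF f] by (simp add: PiE_iff Pi_iff)
  qed
  then show ?thesis
    unfolding block_def state_space_def split_beta' by measurable
qed

definition block_law :: "nat \<Rightarrow> bool \<Rightarrow> (nat \<Rightarrow> 'a) \<Rightarrow> 'a \<Rightarrow> 'a prog_state measure" where
  "block_law n heads x y = Q (x n, y) \<bind> (\<lambda>z. return S (block n heads x y z))"

lemma measurable_block_law:
  "(\<lambda>(x, y). block_law n heads x y) \<in> paths \<Otimes>\<^sub>M M \<rightarrow>\<^sub>M prob_algebra S"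
proof -
  have "(\<lambda>w. Q (fst w n, snd w)) \<in> paths \<Otimes>\<^sub>M M \<rightarrow>\<^sub>M prob_algebra (\<Pi>\<^sub>M i\<in>{1..<m}. M)"
    by (rule measurable_compose[OF _ measurable_Q]) measurable
  moreover have "(\<lambda>(w, z). return S (block n heads (fst w) (snd w) z))
      \<in> (paths \<Otimes>\<^sub>M M) \<Otimes>\<^sub>M (\<Pi>\<^sub>M i\<in>{1..<m}. M) \<rightarrow>\<^sub>M prob_algebra S"
    using measurable_compose[OF measurable_block measurable_return_prob_space]
    by (simp add: split_beta')
  ultimately have "(\<lambda>w. Q (fst w n, snd w) \<bind> (\<lambda>z. return S (block n heads (fst w) (snd w) z)))
      \<in> paths \<Otimes>\<^sub>M M \<rightarrow>\<^sub>M prob_algebra S"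
    by (rule measurable_bind_prob_space2)
  then show ?thesis by (simp add: block_law_def split_beta')
qed

lemma measurable_block_law1:
  "(\<forall>k. x k \<in> space M) \<Longrightarrow> block_law n heads x \<in> M \<rightarrow>\<^sub>M prob_algebra S"
  using measurable_compose[OF measurable_Pair1' measurable_block_law[of n heads], of x]
  by (simp add: space_PiM PiE_iff)

text \<open>A function of the clock, the recorded value and the current state is constant over the intermediate
states of a block, so its mean is its value at the endpoint \<open>y\<close>.\<close>

lemma nn_integral_block_law:
  fixes h :: "nat \<Rightarrow> enat \<Rightarrow> 'a \<Rightarrow> ennreal"
  assumes x: "\<forall>k. x k \<in> space M" and y: "y \<in> space M"
    and g: "(\<lambda>(n, x, \<tau>). h n \<tau> (x n)) \<in> borel_measurable S"
  shows "(\<integral>\<^sup>+ (n, x, \<tau>). h n \<tau> (x n) \<partial>block_law n heads x y) =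
    h (n + m) (if heads then enat (n + m) else \<infinity>) y"
proof -
  let ?Z = "\<Pi>\<^sub>M i\<in>{1..<m}. M"
  let ?g = "\<lambda>(n, x, \<tau>). h n \<tau> (x n)"
  have Q: "Q (x n, y) \<in> space (prob_algebra ?Z)"
    using measurable_space[OF measurable_Q, of "(x n, y)"] x y by (simp add: space_pair_measure)
  then have Qs: "sets (Q (x n, y)) = sets ?Z" "prob_space (Q (x n, y))"
    by (auto simp: space_prob_algebra)
  have "(x, y) \<in> space (paths \<Otimes>\<^sub>M M)"
    using x y by (simp add: space_pair_measure space_PiM PiE_iff)
  from measurable_compose[OF measurable_Pair1'[OF this] measurable_block[of n heads]]
  have b: "block n heads x y \<in> Q (x n, y) \<rightarrow>\<^sub>M S"
    by (simp cong: measurable_cong_sets add: Qs)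
  have "(\<integral>\<^sup>+ s. ?g s \<partial>block_law n heads x y) =
      (\<integral>\<^sup>+ z. \<integral>\<^sup>+ s. ?g s \<partial>return S (block n heads x y z) \<partial>Q (x n, y))"
    unfolding block_law_def
    by (rule nn_integral_bind[OF g measurable_compose[OF b return_measurable]])
  also have "\<dots> = (\<integral>\<^sup>+ z. ?g (block n heads x y z) \<partial>Q (x n, y))"
    by (intro nn_integral_cong nn_integral_return g measurable_space[OF b])
  also have "\<dots> = h (n + m) (if heads then enat (n + m) else \<infinity>) y"
    using m prob_space.emeasure_space_1[OF Qs(2)] by (simp add: block_def)
  finally show ?thesis .
qed

definition step_law :: "nat \<Rightarrow> (nat \<Rightarrow> 'a) \<Rightarrow> enat \<Rightarrow> 'a prog_state measure" where
  "step_law n x \<tau> = P (x n) \<bind> (\<lambda>y. return S (n + 1, x(n + 1 := y), \<tau>))"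

text \<open>The branch of a round that flips the coin, with the tail law in place of the remainder. It is a probability
kernel on all states, as needed for measurability and for the Ionescu-Tulcea construction.\<close>

definition coin_law :: "nat \<Rightarrow> (nat \<Rightarrow> 'a) \<Rightarrow> 'a prog_state measure" where
  "coin_law n x = measure_pmf (bernoulli_pmf \<epsilon>) \<bind>
    (\<lambda>heads. (if heads then \<nu> else tail_law (x n)) \<bind> block_law n heads x)"

text \<open>The zero measure on a nonempty space is a subprobability; hence the branches of
the coin form a subprobability kernel, as the monad laws for the bind require, also for \<open>\<epsilon> = 1\<close>.\<close>

lemma remainder_law_in:
  assumes x: "x \<in> C" and eps: "\<epsilon> = 1"
  shows "remainder_law M P m \<epsilon> \<nu> x \<in> space (subprob_algebra M)"
proof -
  have "emeasure (remainder_law M P m \<epsilon> \<nu> x) A = 0" for A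
    by (simp add: remainder_law_def eps)
  moreover have "space M \<noteq> {}" using C_space[OF x] by auto
  ultimately show ?thesis
    using sets_remainder_law[OF x] sets_eq_imp_space_eq[OF sets_remainder_law[OF x]]
    by (auto simp: space_subprob_algebra intro!: subprob_spaceI)
qed

lemma round_kernel_eq:
  assumes x: "\<forall>k. x k \<in> space M"
  shows "round_kernel M P C m \<epsilon> \<nu> Q (n, x, \<tau>) =
    (if \<tau> = \<infinity> \<and> x n \<in> C then coin_law n x else step_law n x \<tau>)"
proof -
  let ?F = "\<lambda>T heads. (if heads then \<nu> else T) \<bind> block_law n heads x"
  have "measure_pmf (bernoulli_pmf \<epsilon>) \<bind> ?F (remainder_law M P m \<epsilon> \<nu> (x n)) = coin_law n x"
    if "x n \<in> C"
  \<comment> \<open>For \<open>\<epsilon> = 1\<close> the coin shows heads with certainty, so both sides equal their heads branch.\<close>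
  proof (cases "\<epsilon> = 1")
    case True
    have bind_in: "N \<bind> block_law n heads x \<in> space (subprob_algebra S)"
      if "N \<in> space (subprob_algebra M)" for N heads
      using measurable_space[OF measurable_bind2[OF measurable_const[OF that]
        measurable_prob_algebraD[OF measurable_block_law1[OF x, of n heads]]], of undefined "count_space UNIV"]
      by simp
    have law_sub: "N \<in> space (prob_algebra M) \<Longrightarrow> N \<in> space (subprob_algebra M)" for N
      by (auto simp: space_prob_algebra space_subprob_algebra prob_space_imp_subprob_space)
    have "measure_pmf (bernoulli_pmf \<epsilon>) \<bind> ?F T = ?F T True"
      if "T \<in> space (subprob_algebra M)" for T
    proof -
      have "bernoulli_pmf \<epsilon> = return_pmf True"
        by (rule pmf_eqI) (auto simp: True indicator_def pmf_return split: bool.split)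
      then have "measure_pmf (bernoulli_pmf \<epsilon>) = return (count_space UNIV) True"
        by (simp add: return_pmf.rep_eq)
      moreover have "?F T \<in> count_space UNIV \<rightarrow>\<^sub>M subprob_algebra S"
        using bind_in[OF that] bind_in[OF law_sub[OF nu]] by auto
      ultimately show ?thesis by (simp add: bind_return)
    qed
    with remainder_law_in[OF that True] law_sub[OF tail_law_in[of "x n"]] x
    show ?thesis by (simp add: coin_law_def)
  next
    case False
    with eps_le_1 have "\<epsilon> < 1" by simp
    with that have eq: "tail_law (x n) = remainder_law M P m \<epsilon> \<nu> (x n)" by (simp add: tail_law_def)
    show ?thesis unfolding coin_law_def eq ..
  qed
  moreover have "block_law n heads x = (\<lambda>y. Q (x n, y) \<bind> (\<lambda>z. return S
      (n + m, (\<lambda>k. if n < k \<and> k < n + m then z (k - n) else if k = n + m then y else x k),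
       if heads then enat (n + m) else \<infinity>)))" for heads
    by (simp add: block_law_def block_def fun_eq_iff)
  ultimately show ?thesis
    by (simp add: round_kernel_def step_law_def)
qed

lemma measurable_coin_law: "coin_law n \<in> paths \<rightarrow>\<^sub>M prob_algebra S"
proof -
  have [measurable]: "(\<lambda>x. tail_law (x n)) \<in> paths \<rightarrow>\<^sub>M prob_algebra M"
    by (rule measurable_compose[OF _ measurable_tail_law]) measurable
  have "(\<lambda>x. (if heads then \<nu> else tail_law (x n)) \<bind> block_law n heads x) \<in> paths \<rightarrow>\<^sub>M prob_algebra S"
    for heads
    by (rule measurable_bind_prob_space2[OF _ measurable_block_law])
      (cases heads; simp add: nu)
  then have "(\<lambda>w. (if snd w then \<nu> else tail_law (fst w n)) \<bind> block_law n (snd w) (fst w))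
      \<in> paths \<Otimes>\<^sub>M count_space UNIV \<rightarrow>\<^sub>M prob_algebra S"
    by (intro measurable_compose_countable[where f="\<lambda>heads w. (if heads then \<nu> else tail_law (fst w n)) \<bind> block_law n heads (fst w)" and g=snd]
        measurable_compose[OF measurable_fst]) auto
  moreover have "measure_pmf (bernoulli_pmf \<epsilon>) \<in> space (prob_algebra (count_space UNIV))"
    by (simp add: space_prob_algebra measure_pmf.prob_space_axioms)
  ultimately show ?thesis
    unfolding coin_law_def[abs_def]
    by (intro measurable_bind_prob_space2[where N="count_space UNIV"]) (auto simp: split_beta')
qed

lemma measurable_step: "(\<lambda>(x, y). (n + 1, x(n + 1 := y), \<tau>)) \<in> paths \<Otimes>\<^sub>M M \<rightarrow>\<^sub>M S"
proof -
  have "(\<lambda>w. (fst w)(n + 1 := snd w)) \<in> paths \<Otimes>\<^sub>M M \<rightarrow>\<^sub>M paths"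
    by (rule measurable_fun_upd[where J=UNIV]) auto
  then show ?thesis unfolding state_space_def split_beta' by measurable
qed

lemma measurable_step_law: "(\<lambda>x. step_law n x \<tau>) \<in> paths \<rightarrow>\<^sub>M prob_algebra S"
proof -
  have "(\<lambda>x. P (x n)) \<in> paths \<rightarrow>\<^sub>M prob_algebra M"
    by (rule measurable_compose[OF _ kernel]) measurable
  moreover have "(\<lambda>(x, y). return S (n + 1, x(n + 1 := y), \<tau>)) \<in> paths \<Otimes>\<^sub>M M \<rightarrow>\<^sub>M prob_algebra S"
    using measurable_compose[OF measurable_step measurable_return_prob_space] by (simp add: split_beta')
  ultimately show ?thesis unfolding step_law_def by (rule measurable_bind_prob_space2)
qed

lemma measurable_round_kernel: "round_kernel M P C m \<epsilon> \<nu> Q \<in> S \<rightarrow>\<^sub>M prob_algebra S"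
proof -
  have "(\<lambda>(n, x, \<tau>). if \<tau> = \<infinity> \<and> x n \<in> C then coin_law n x else step_law n x \<tau>) \<in> S \<rightarrow>\<^sub>M prob_algebra S"
  proof (rule measurable_state_space_split)
    fix n and \<tau> :: enat
    have "{x \<in> space paths. \<tau> = \<infinity> \<and> x n \<in> C} \<in> sets paths" by measurable
    then show "(\<lambda>x. if \<tau> = \<infinity> \<and> x n \<in> C then coin_law n x else step_law n x \<tau>) \<in> paths \<rightarrow>\<^sub>M prob_algebra S"
      by (intro measurable_If measurable_coin_law measurable_step_law)
  qed
  then show ?thesis
    by (rule measurable_cong[THEN iffD1, rotated])
      (auto simp: space_state_space round_kernel_eq split: prod.splits)
qed

lemma nn_integral_coin_law:
  fixes h :: "nat \<Rightarrow> enat \<Rightarrow> 'a \<Rightarrow> ennreal"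
  assumes x: "\<forall>k. x k \<in> space M"
    and g: "(\<lambda>(n, x, \<tau>). h n \<tau> (x n)) \<in> borel_measurable S"
  shows "(\<integral>\<^sup>+ (n, x, \<tau>). h n \<tau> (x n) \<partial>coin_law n x) =
    ennreal \<epsilon> * (\<integral>\<^sup>+ y. h (n + m) (enat (n + m)) y \<partial>\<nu>) +
    ennreal (1 - \<epsilon>) * (\<integral>\<^sup>+ y. h (n + m) \<infinity> y \<partial>tail_law (x n))"
proof -
  let ?g = "\<lambda>(n, x, \<tau>). h n \<tau> (x n)"
  have bl: "N \<bind> block_law n heads x \<in> space (prob_algebra S)"
      "(\<integral>\<^sup>+ s. ?g s \<partial>(N \<bind> block_law n heads x)) =
        (\<integral>\<^sup>+ y. h (n + m) (if heads then enat (n + m) else \<infinity>) y \<partial>N)"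
    if N: "N \<in> space (prob_algebra M)" for N heads
  proof -
    note b = measurable_block_law1[OF x, of n heads]
    show "N \<bind> block_law n heads x \<in> space (prob_algebra S)"
      using prob_space_bind'[OF N b] sets_bind'[OF N b] by (simp add: space_prob_algebra)
    have "block_law n heads x \<in> N \<rightarrow>\<^sub>M subprob_algebra S"
      using measurable_prob_algebraD[OF b] by (simp cong: measurable_cong_sets add: law_props(1)[OF N])
    from nn_integral_bind[OF g this]
    have "(\<integral>\<^sup>+ s. ?g s \<partial>(N \<bind> block_law n heads x)) = (\<integral>\<^sup>+ y. \<integral>\<^sup>+ s. ?g s \<partial>block_law n heads x y \<partial>N)" .
    also have "\<dots> = (\<integral>\<^sup>+ y. h (n + m) (if heads then enat (n + m) else \<infinity>) y \<partial>N)"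
      by (intro nn_integral_cong nn_integral_block_law[OF x _ g]) (simp add: law_props(2)[OF N])
    finally show "(\<integral>\<^sup>+ s. ?g s \<partial>(N \<bind> block_law n heads x)) =
        (\<integral>\<^sup>+ y. h (n + m) (if heads then enat (n + m) else \<infinity>) y \<partial>N)" .
  qed
  have tl: "tail_law (x n) \<in> space (prob_algebra M)" using x tail_law_in by auto
  have "(\<lambda>heads. (if heads then \<nu> else tail_law (x n)) \<bind> block_law n heads x)
      \<in> measure_pmf (bernoulli_pmf \<epsilon>) \<rightarrow>\<^sub>M prob_algebra S"
    using bl(1)[OF nu] bl(1)[OF tl] by (simp add: measurable_pmf_measure1)
  from nn_integral_bind[OF g measurable_prob_algebraD[OF this]] show ?thesis
    using eps_pos eps_le_1 by (simp add: coin_law_def bl(2)[OF nu] bl(2)[OF tl] mult.commute)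
qed

lemma nn_integral_step_law:
  fixes h :: "nat \<Rightarrow> enat \<Rightarrow> 'a \<Rightarrow> ennreal"
  assumes x: "\<forall>k. x k \<in> space M"
    and g: "(\<lambda>(n, x, \<tau>). h n \<tau> (x n)) \<in> borel_measurable S"
  shows "(\<integral>\<^sup>+ (n, x, \<tau>). h n \<tau> (x n) \<partial>step_law n x \<tau>) = (\<integral>\<^sup>+ y. h (n + 1) \<tau> y \<partial>P (x n))"
proof -
  have N: "P (x n) \<in> space (prob_algebra M)" using x kernel_in by auto
  have "x \<in> space paths" using x by (simp add: space_PiM PiE_iff)
  from measurable_compose[OF measurable_Pair1'[OF this] measurable_step[of n \<tau>]]
  have b: "(\<lambda>y. (n + 1, x(n + 1 := y), \<tau>)) \<in> P (x n) \<rightarrow>\<^sub>M S"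
    by (simp cong: measurable_cong_sets add: law_props(1)[OF N])
  show ?thesis
    unfolding step_law_def nn_integral_bind[OF g measurable_compose[OF b return_measurable]]
    by (intro nn_integral_cong, subst nn_integral_return[OF measurable_space[OF b] g]) auto
qed

abbreviation "rnd \<equiv> round_kernel M P C m \<epsilon> \<nu> Q"

lemma measurable_split_state:
  assumes "\<And>n \<tau>. h n \<tau> \<in> M \<rightarrow>\<^sub>M N"
  shows "(\<lambda>(n, x, \<tau>). h n \<tau> (x n)) \<in> S \<rightarrow>\<^sub>M N"
  by (rule measurable_state_space_split) (rule measurable_compose[OF _ assms], measurable)

lemma nn_integral_round:
  fixes h :: "nat \<Rightarrow> enat \<Rightarrow> 'a \<Rightarrow> ennreal"
  assumes h: "\<And>n \<tau>. h n \<tau> \<in> borel_measurable M"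
    and x: "\<forall>k. x k \<in> space M"
  shows "(\<integral>\<^sup>+ (n, x, \<tau>). h n \<tau> (x n) \<partial>rnd (n, x, \<tau>)) =
    (if \<tau> = \<infinity> \<and> x n \<in> C then
       ennreal \<epsilon> * (\<integral>\<^sup>+ y. h (n + m) (enat (n + m)) y \<partial>\<nu>) +
       ennreal (1 - \<epsilon>) * (\<integral>\<^sup>+ y. h (n + m) \<infinity> y \<partial>tail_law (x n))
     else (\<integral>\<^sup>+ y. h (n + 1) \<tau> y \<partial>P (x n)))"
  using nn_integral_coin_law[OF x measurable_split_state[OF h]]
    nn_integral_step_law[OF x measurable_split_state[OF h]]
  by (simp add: round_kernel_eq[OF x])

section \<open>A supermartingale that dominates survival\<close>

text \<open>An upper bound for the probability of \<open>T \<ge> N + m\<close>, given that the clock shows \<open>n\<close>, the chain is at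
\<open>y\<close> and the recorded value is \<open>\<tau>\<close>. The truncated subtraction stops the discounting once the clock
has reached \<open>N\<close>; the bound is then \<open>1\<close>, since \<open>V \<ge> 1\<close>.\<close>

definition survival_bound :: "nat \<Rightarrow> nat \<Rightarrow> enat \<Rightarrow> 'a \<Rightarrow> ennreal" where
  "survival_bound N n \<tau> y =
    (if \<tau> = \<infinity> then min 1 (ennreal (\<rho> ^ (N - n) * V y powr r)) else of_bool (enat (N + m) \<le> \<tau>))"

lemma measurable_survival_bound[measurable]: "survival_bound N n \<tau> \<in> borel_measurable M"
  unfolding survival_bound_def[abs_def] by (cases "\<tau> = \<infinity>") simp_all

lemma survival_bound_le_1: "survival_bound N n \<tau> y \<le> 1"
  by (simp add: survival_bound_def)

lemma V_powr_ge_1: "y \<in> space M \<Longrightarrow> 1 \<le> V y powr r"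
  using rate V_ge_1 by (simp add: ge_one_powr_ge_zero)

lemma mean_survival_bound_le_1:
  assumes "L \<in> space (prob_algebra M)" shows "(\<integral>\<^sup>+ y. survival_bound N n \<tau> y \<partial>L) \<le> 1"
proof -
  have "(\<integral>\<^sup>+ y. survival_bound N n \<tau> y \<partial>L) \<le> (\<integral>\<^sup>+ y. 1 \<partial>L)"
    by (intro nn_integral_mono survival_bound_le_1)
  then show ?thesis unfolding nn_integral_law_const[OF assms] .
qed

lemma mean_survival_bound_le:
  assumes L: "L \<in> space (prob_algebra M)"
  shows "(\<integral>\<^sup>+ y. survival_bound N n \<infinity> y \<partial>L) \<le> ennreal (\<rho> ^ (N - n)) * (\<integral>\<^sup>+ y. ennreal (V y powr r) \<partial>L)"
proof -
  have "(\<integral>\<^sup>+ y. survival_bound N n \<infinity> y \<partial>L) \<le> (\<integral>\<^sup>+ y. ennreal (\<rho> ^ (N - n)) * ennreal (V y powr r) \<partial>L)"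
    using rate by (intro nn_integral_mono) (simp add: survival_bound_def ennreal_mult)
  also have "\<dots> = ennreal (\<rho> ^ (N - n)) * (\<integral>\<^sup>+ y. ennreal (V y powr r) \<partial>L)"
    by (rule nn_integral_cmult) (simp cong: measurable_cong_sets add: law_props(1)[OF L])
  finally show ?thesis .
qed

lemma survival_bound_late: "N \<le> n \<Longrightarrow> y \<in> space M \<Longrightarrow> survival_bound N n \<infinity> y = 1"
  using V_powr_ge_1[of y] by (simp add: survival_bound_def min_def flip: ennreal_1)

text \<open>A round that starts at time \<open>n < N\<close> and succeeds sets \<open>T = n + m < N + m\<close>, so the heads branch
contributes nothing; the tails branch is controlled by \<open>tail_V_powr_le\<close> and a step outside \<open>C\<close> by the
drift of \<open>V\<^sup>r\<close>. From time \<open>N\<close> on, the trivial bound \<open>1\<close> is enough.\<close>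

lemma survival_bound_round:
  assumes x: "\<forall>k. x k \<in> space M"
  shows "(\<integral>\<^sup>+ (n, x, \<tau>). survival_bound N n \<tau> (x n) \<partial>rnd (n, x, \<tau>)) \<le> survival_bound N n \<tau> (x n)"
proof -
  have xn: "x n \<in> space M" using x by auto
  note px = kernel_in[OF xn] and tx = tail_law_in[OF xn]
  note \<rho> = rate(1,2)
  consider (stopped) "\<tau> \<noteq> \<infinity>" | (late) "\<tau> = \<infinity>" "N \<le> n"
    | (outside) "\<tau> = \<infinity>" "n < N" "x n \<notin> C" | (inside) "\<tau> = \<infinity>" "n < N" "x n \<in> C"
    by fastforce
  then show ?thesis
  proof cases
    case stopped
    then have "survival_bound N (n + 1) \<tau> = (\<lambda>_. survival_bound N n \<tau> (x n))"
      by (auto simp: survival_bound_def fun_eq_iff)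
    with stopped show ?thesis
      by (auto simp: nn_integral_round[OF measurable_survival_bound x] nn_integral_law_const[OF px]
        simp del: nn_integral_const)
  next
    case late
    have "ennreal \<epsilon> * (\<integral>\<^sup>+ y. survival_bound N (n + m) (enat (n + m)) y \<partial>\<nu>) +
        ennreal (1 - \<epsilon>) * (\<integral>\<^sup>+ y. survival_bound N (n + m) \<infinity> y \<partial>tail_law (x n))
      \<le> ennreal \<epsilon> * 1 + ennreal (1 - \<epsilon>) * 1"
      by (intro add_mono mult_left_mono mean_survival_bound_le_1 nu tx) auto
    also have "\<dots> = 1" using eps_pos eps_le_1 by (simp flip: ennreal_plus)
    finally show ?thesis
      using late survival_bound_late[OF late(2) xn] mean_survival_bound_le_1[OF px]
      by (simp add: nn_integral_round[OF measurable_survival_bound x])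
  next
    case outside
    have "(\<integral>\<^sup>+ y. survival_bound N (n + 1) \<infinity> y \<partial>P (x n))
        \<le> ennreal (\<rho> ^ (N - (n + 1))) * (\<integral>\<^sup>+ y. ennreal (V y powr r) \<partial>P (x n))"
      by (rule mean_survival_bound_le[OF px])
    also have "\<dots> \<le> ennreal (\<rho> ^ (N - (n + 1))) * ennreal (\<rho> * V (x n) powr r)"
      by (intro mult_left_mono outside_V_powr_le xn outside) simp
    also have "\<dots> = ennreal (\<rho> ^ (N - (n + 1)) * (\<rho> * V (x n) powr r))"
      using \<rho> by (simp add: ennreal_mult)
    also have "\<rho> ^ (N - (n + 1)) * (\<rho> * V (x n) powr r) = \<rho> ^ Suc (N - (n + 1)) * V (x n) powr r"
      by simp
    also have "Suc (N - (n + 1)) = N - n" using outside by simp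
    finally show ?thesis
      using outside mean_survival_bound_le_1[OF px, of N "n + 1" \<infinity>]
      by (simp add: nn_integral_round[OF measurable_survival_bound x] survival_bound_def[of N n \<infinity> "x n"])
  next
    case inside
    let ?tails = "ennreal (1 - \<epsilon>) * (\<integral>\<^sup>+ y. survival_bound N (n + m) \<infinity> y \<partial>tail_law (x n))"
    have "?tails \<le> ennreal (1 - \<epsilon>) * (ennreal (\<rho> ^ (N - (n + m))) * (\<integral>\<^sup>+ y. ennreal (V y powr r) \<partial>tail_law (x n)))"
      by (intro mult_left_mono mean_survival_bound_le[OF tx]) simp
    also have "\<dots> = ennreal (\<rho> ^ (N - (n + m))) * (ennreal (1 - \<epsilon>) * (\<integral>\<^sup>+ y. ennreal (V y powr r) \<partial>tail_law (x n)))"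
      by (simp add: ac_simps)
    also have "\<dots> \<le> ennreal (\<rho> ^ (N - (n + m))) * ennreal (\<rho> ^ m)"
      by (intro mult_left_mono tail_V_powr_le inside) simp
    also have "\<dots> = ennreal (\<rho> ^ (N - (n + m) + m))"
      using \<rho> by (simp add: power_add ennreal_mult)
    also have "\<dots> \<le> ennreal (\<rho> ^ (N - n) * V (x n) powr r)"
    proof (rule ennreal_leI)
      \<comment> \<open>If the block overshoots \<open>N\<close>, then \<open>N - (n + m) + m = m\<close> exceeds \<open>N - n\<close>, which only helps as \<open>\<rho> < 1\<close>.\<close>
      have "\<rho> ^ (N - (n + m) + m) \<le> \<rho> ^ (N - n) * 1"
        using \<rho> power_decreasing[of "N - n" "N - (n + m) + m" \<rho>] by simp
      also have "\<dots> \<le> \<rho> ^ (N - n) * V (x n) powr r"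
        using \<rho> V_powr_ge_1[OF xn] by (intro mult_left_mono) auto
      finally show "\<rho> ^ (N - (n + m) + m) \<le> \<rho> ^ (N - n) * V (x n) powr r" .
    qed
    finally have 1: "?tails \<le> ennreal (\<rho> ^ (N - n) * V (x n) powr r)" .
    have "?tails \<le> ennreal (1 - \<epsilon>) * 1"
      by (intro mult_left_mono mean_survival_bound_le_1 tx) simp
    also have "\<dots> \<le> 1" using eps_pos by simp
    finally have 2: "?tails \<le> 1" .
    have "(\<integral>\<^sup>+ y. survival_bound N (n + m) (enat (n + m)) y \<partial>\<nu>) = 0"
      using inside by (simp add: survival_bound_def)
    with 1 2 show ?thesis
      using inside
      by (simp add: nn_integral_round[OF measurable_survival_bound x] survival_bound_def[of N n \<infinity> "x n"])
  qed
qed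

section \<open>Law of the regeneration time\<close>

lemma init_law_in:
  assumes \<mu>: "\<mu> \<in> space (prob_algebra M)" shows "init_law M \<mu> \<in> space (prob_algebra S)"
    and "(\<lambda>x. (0, \<lambda>_. x, \<infinity>)) \<in> \<mu> \<rightarrow>\<^sub>M S"
proof -
  have "(\<lambda>x (_::nat). x) \<in> M \<rightarrow>\<^sub>M paths"
    by (rule measurable_PiM_single') (auto simp: PiE_iff)
  then have "(\<lambda>x. (0, \<lambda>_. x, \<infinity>)) \<in> M \<rightarrow>\<^sub>M S" unfolding state_space_def by measurable
  then show *: "(\<lambda>x. (0, \<lambda>_. x, \<infinity>)) \<in> \<mu> \<rightarrow>\<^sub>M S"
    by (simp cong: measurable_cong_sets add: law_props(1)[OF \<mu>])
  show "init_law M \<mu> \<in> space (prob_algebra S)"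
    using prob_space.prob_space_distr[OF law_props(3)[OF \<mu>] *] by (simp add: space_prob_algebra init_law_def)
qed

abbreviation "run \<mu> \<equiv> run_law M P C m \<epsilon> \<nu> Q \<mu>"

lemma run_prob_space:
  assumes \<mu>: "\<mu> \<in> space (prob_algebra M)"
  shows "prob_space (run \<mu>)" "sets (run \<mu>) = sets (\<Pi>\<^sub>M i\<in>UNIV. S)" "space (run \<mu>) = space (\<Pi>\<^sub>M i\<in>UNIV. S)"
proof -
  show "prob_space (run \<mu>)" and *: "sets (run \<mu>) = sets (\<Pi>\<^sub>M i\<in>UNIV. S)"
    unfolding run_law_def
    using markov_run_prob_space[OF init_law_in(1)[OF \<mu>] measurable_round_kernel] by blast+
  show "space (run \<mu>) = space (\<Pi>\<^sub>M i\<in>UNIV. S)" by (rule sets_eq_imp_space_eq[OF *])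
qed

lemma run_supermartingale:
  fixes h :: "nat \<Rightarrow> nat \<Rightarrow> enat \<Rightarrow> 'a \<Rightarrow> ennreal"
  assumes \<mu>: "\<mu> \<in> space (prob_algebra M)"
    and h: "\<And>k n \<tau>. h k n \<tau> \<in> borel_measurable M"
    and step: "\<And>k n x \<tau>. \<forall>i. x i \<in> space M \<Longrightarrow>
      (\<integral>\<^sup>+ (n, x, \<tau>). h (Suc k) n \<tau> (x n) \<partial>rnd (n, x, \<tau>)) \<le> h k n \<tau> (x n)"
  shows "(\<integral>\<^sup>+ \<omega>. (case \<omega> k of (n, x, \<tau>) \<Rightarrow> h k n \<tau> (x n)) \<partial>run \<mu>) \<le> (\<integral>\<^sup>+ y. h 0 0 \<infinity> y \<partial>\<mu>)"
proof -
  have "(\<integral>\<^sup>+ \<omega>. (case \<omega> k of (n, x, \<tau>) \<Rightarrow> h k n \<tau> (x n)) \<partial>run \<mu>)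
      \<le> (\<integral>\<^sup>+ (n, x, \<tau>). h 0 n \<tau> (x n) \<partial>init_law M \<mu>)"
    unfolding run_law_def
  proof (rule markov_supermartingale[where g="\<lambda>k (n, x, \<tau>). h k n \<tau> (x n)",
        OF init_law_in(1)[OF \<mu>] measurable_round_kernel measurable_split_state[OF h]])
    fix k and s :: "'a prog_state" assume s: "s \<in> space S"
    obtain n x \<tau> where eq: "s = (n, x, \<tau>)" by (cases s)
    show "(\<integral>\<^sup>+ (n, x, \<tau>). h (Suc k) n \<tau> (x n) \<partial>rnd s) \<le> (case s of (n, x, \<tau>) \<Rightarrow> h k n \<tau> (x n))"
      using step[where x=x and k=k and n=n and \<tau>=\<tau>] s unfolding eq space_state_space by simp
  qed
  also have "\<dots> = (\<integral>\<^sup>+ y. h 0 0 \<infinity> y \<partial>\<mu>)"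
  proof -
    have "(\<lambda>(n, x, \<tau>). h 0 n \<tau> (x n)) \<in> borel_measurable (distr \<mu> S (\<lambda>x. (0, \<lambda>_. x, \<infinity>)))"
      unfolding measurable_distr_eq1 by (rule measurable_split_state) (rule h)
    from nn_integral_distr[OF init_law_in(2)[OF \<mu>] this] show ?thesis
      by (simp add: init_law_def)
  qed
  finally show ?thesis .
qed

text \<open>Each round advances the clock by \<open>1\<close> or by \<open>m \<ge> 1\<close>, so after \<open>k\<close> rounds it shows at least \<open>k\<close> almost
surely.\<close>

lemma clock_lag:
  assumes \<mu>: "\<mu> \<in> space (prob_algebra M)"
  shows "(\<integral>\<^sup>+ \<omega>. of_bool (fst (\<omega> k) < k) \<partial>run \<mu>) = 0"
proof -
  let ?h = "\<lambda>(k::nat) (n::nat) (\<tau>::enat) (y::'a). of_bool (n < k) :: ennreal"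
  have "(\<integral>\<^sup>+ (n, x, \<tau>). ?h (Suc k) n \<tau> (x n) \<partial>rnd (n, x, \<tau>)) \<le> ?h k n \<tau> (x n)"
    if x: "\<forall>i. x i \<in> space M" for k n x \<tau>
  proof -
    have xn: "x n \<in> space M" using x by auto
    have "(\<integral>\<^sup>+ (n, x, \<tau>). ?h (Suc k) n \<tau> (x n) \<partial>rnd (n, x, \<tau>)) =
       (if \<tau> = \<infinity> \<and> x n \<in> C then ennreal \<epsilon> * of_bool (n + m < Suc k) + ennreal (1 - \<epsilon>) * of_bool (n + m < Suc k)
        else of_bool (n + 1 < Suc k))"
      by (subst nn_integral_round[OF _ x])
       (simp_all only: borel_measurable_const nn_integral_law_const[OF nu] nn_integral_law_const[OF tail_law_in[OF xn]]
        nn_integral_law_const[OF kernel_in[OF xn]])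
    also have "\<dots> \<le> of_bool (n < k)"
      using m eps_pos eps_le_1 by (auto simp flip: ennreal_plus)
    finally show ?thesis .
  qed
  note step = this
  have "(\<integral>\<^sup>+ \<omega>. (case \<omega> k of (n, x, \<tau>) \<Rightarrow> ?h k n \<tau> (x n)) \<partial>run \<mu>) \<le> (\<integral>\<^sup>+ y. ?h 0 0 \<infinity> y \<partial>\<mu>)"
    by (rule run_supermartingale[where h="?h" and k=k, OF \<mu> borel_measurable_const step])
  then show ?thesis by (simp add: case_prod_unfold)
qed

lemma measurable_run_time:
  assumes \<mu>: "\<mu> \<in> space (prob_algebra M)"
  shows "(\<lambda>\<omega>. snd (snd (\<omega> k))) \<in> run \<mu> \<rightarrow>\<^sub>M count_space UNIV"
proof -
  have "(\<lambda>\<omega>. \<omega> k) \<in> run \<mu> \<rightarrow>\<^sub>M S"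
    by (simp add: measurable_cong_sets[OF run_prob_space(2)[OF \<mu>] refl])
  moreover have "(\<lambda>s. snd (snd s)) \<in> S \<rightarrow>\<^sub>M count_space UNIV"
    unfolding state_space_def by measurable
  ultimately show ?thesis by (rule measurable_compose)
qed

lemma measurable_regen_time:
  assumes \<mu>: "\<mu> \<in> space (prob_algebra M)"
  shows "regen_time \<in> run \<mu> \<rightarrow>\<^sub>M count_space UNIV"
  unfolding regen_time_def[abs_def] by (rule measurable_INF[OF _ measurable_run_time[OF \<mu>]]) simp

text \<open>\<open>T\<close> is a lower bound for every recorded value, in particular for the one after \<open>N\<close> rounds. At that
moment the clock shows at least \<open>N\<close>, and there \<open>survival_bound\<close> dominates the indicator of a recorded
value of at least \<open>N + m\<close>.\<close>

lemma survival_le: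
  assumes \<mu>: "\<mu> \<in> space (prob_algebra M)"
  shows "ennreal (\<P>(\<omega> in run \<mu>. enat (N + m) \<le> regen_time \<omega>)) \<le> (\<integral>\<^sup>+ y. survival_bound N 0 \<infinity> y \<partial>\<mu>)"
proof -
  note R = run_prob_space[OF \<mu>]
  interpret R: prob_space "run \<mu>" by (rule R(1))
  have state[measurable]: "(\<lambda>\<omega>. \<omega> k) \<in> run \<mu> \<rightarrow>\<^sub>M S" for k
    by (simp add: measurable_cong_sets[OF R(2) refl])
  have clock[measurable]: "fst \<in> S \<rightarrow>\<^sub>M count_space UNIV" and time[measurable]: "(\<lambda>s. snd (snd s)) \<in> S \<rightarrow>\<^sub>M count_space UNIV"
    unfolding state_space_def by measurable
  let ?A = "{\<omega> \<in> space (run \<mu>). enat (N + m) \<le> snd (snd (\<omega> N))}"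
  have "?A \<in> sets (run \<mu>)" by measurable
  let ?g = "\<lambda>(n, x, \<tau>). survival_bound N n \<tau> (x n)"
  have g: "(\<lambda>\<omega>. ?g (\<omega> N)) \<in> borel_measurable (run \<mu>)"
    by (rule measurable_compose[OF state measurable_split_state[OF measurable_survival_bound]])
  have "ennreal (\<P>(\<omega> in run \<mu>. enat (N + m) \<le> regen_time \<omega>)) \<le> ennreal (measure (run \<mu>) ?A)"
    by (intro ennreal_leI R.finite_measure_mono \<open>?A \<in> _\<close>) (auto simp: regen_time_def le_INF_iff)
  also have "\<dots> = (\<integral>\<^sup>+ \<omega>. indicator ?A \<omega> \<partial>run \<mu>)"
    using \<open>?A \<in> _\<close> by (simp add: R.emeasure_eq_measure)
  \<comment> \<open>The second summand covers the null event that the clock lags behind.\<close>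
  also have "\<dots> \<le> (\<integral>\<^sup>+ \<omega>. ?g (\<omega> N) + of_bool (fst (\<omega> N) < N) \<partial>run \<mu>)"
  proof (rule nn_integral_mono)
    fix \<omega> assume "\<omega> \<in> space (run \<mu>)"
    then have S: "\<omega> N \<in> space S" by (simp add: R(3) space_PiM PiE_iff)
    obtain n x \<tau> where s: "\<omega> N = (n, x, \<tau>)" by (cases "\<omega> N")
    then have "x n \<in> space M" using S space_state_space by metis
    then show "indicator ?A \<omega> \<le> ?g (\<omega> N) + of_bool (fst (\<omega> N) < N)"
      using survival_bound_late[of N n "x n"]
      by (cases "n < N"; cases "\<tau> = \<infinity>") (auto simp: s survival_bound_def indicator_def)
  qed
  also have "\<dots> = (\<integral>\<^sup>+ \<omega>. ?g (\<omega> N) \<partial>run \<mu>) + (\<integral>\<^sup>+ \<omega>. of_bool (fst (\<omega> N) < N) \<partial>run \<mu>)"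
    by (intro nn_integral_add g) measurable
  also have "\<dots> = (\<integral>\<^sup>+ \<omega>. ?g (\<omega> N) \<partial>run \<mu>)" by (simp add: clock_lag[OF \<mu>])
  also have "\<dots> \<le> (\<integral>\<^sup>+ y. survival_bound N 0 \<infinity> y \<partial>\<mu>)"
    by (rule run_supermartingale[OF \<mu> measurable_survival_bound survival_bound_round])
  finally show ?thesis .
qed

text \<open>The survival bounds at \<open>y\<close> tend to \<open>0\<close> geometrically for each fixed \<open>y\<close> and are at most \<open>1\<close>, so their
\<open>\<mu>\<close>-means tend to \<open>0\<close> by dominated convergence, however heavy the tail of \<open>V\<close> under \<open>\<mu>\<close>.\<close>

lemma regen_time_finite:
  assumes \<mu>: "\<mu> \<in> space (prob_algebra M)"
  shows "\<P>(\<omega> in run \<mu>. regen_time \<omega> < \<infinity>) = 1"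
proof -
  note R = run_prob_space[OF \<mu>]
  interpret R: prob_space "run \<mu>" by (rule R(1))
  interpret \<mu>: prob_space \<mu> by (rule law_props(3)[OF \<mu>])
  have [measurable]: "regen_time \<in> run \<mu> \<rightarrow>\<^sub>M count_space UNIV" by (rule measurable_regen_time[OF \<mu>])
  have "(\<lambda>N. \<integral>\<^sup>+ y. survival_bound N 0 \<infinity> y \<partial>\<mu>) \<longlonglongrightarrow> (\<integral>\<^sup>+ y. 0 \<partial>\<mu>)"
  proof (rule nn_integral_dominated_convergence[where w="\<lambda>_. 1"])
    have "(\<lambda>N. survival_bound N 0 \<infinity> y) \<longlonglongrightarrow> 0" for y
    proof -
      have "(\<lambda>N. \<rho> ^ N * V y powr r) \<longlonglongrightarrow> 0 * V y powr r"
        using rate by (intro tendsto_intros LIMSEQ_realpow_zero) auto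
      from tendsto_ennrealI[OF this] have "(\<lambda>N. ennreal (\<rho> ^ N * V y powr r)) \<longlonglongrightarrow> 0"
        by simp
      then show ?thesis
        by (rule tendsto_sandwich[OF _ _ tendsto_const, rotated 2]) (auto simp: survival_bound_def)
    qed
    then show "AE y in \<mu>. (\<lambda>N. survival_bound N 0 \<infinity> y) \<longlonglongrightarrow> 0" by simp
  qed (auto simp: survival_bound_le_1 \<mu>.emeasure_space_1 measurable_cong_sets[OF law_props(1)[OF \<mu>] refl])
  moreover have "ennreal (\<P>(\<omega> in run \<mu>. regen_time \<omega> = \<infinity>)) \<le> (\<integral>\<^sup>+ y. survival_bound N 0 \<infinity> y \<partial>\<mu>)" for N
  proof -
    have "\<P>(\<omega> in run \<mu>. regen_time \<omega> = \<infinity>) \<le> \<P>(\<omega> in run \<mu>. enat (N + m) \<le> regen_time \<omega>)"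
    proof (rule R.finite_measure_mono)
      show "{\<omega> \<in> space (run \<mu>). enat (N + m) \<le> regen_time \<omega>} \<in> sets (run \<mu>)" by measurable
    qed auto
    from order_trans[OF ennreal_leI[OF this] survival_le[OF \<mu>]] show ?thesis .
  qed
  ultimately have "ennreal (\<P>(\<omega> in run \<mu>. regen_time \<omega> = \<infinity>)) \<le> (\<integral>\<^sup>+ y. 0 \<partial>\<mu>)"
    using LIMSEQ_le_const by blast
  then have "\<P>(\<omega> in run \<mu>. regen_time \<omega> = \<infinity>) = 0"
    by (simp add: measure_le_0_iff)
  moreover have "{\<omega> \<in> space (run \<mu>). regen_time \<omega> < \<infinity>} = {\<omega> \<in> space (run \<mu>). \<not> regen_time \<omega> = \<infinity>}"
    by auto
  moreover have "{\<omega> \<in> space (run \<mu>). regen_time \<omega> = \<infinity>} \<in> sets (run \<mu>)" by measurable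
  ultimately show ?thesis using R.prob_neg[of "\<lambda>\<omega>. regen_time \<omega> = \<infinity>"] by simp
qed

text \<open>With \<open>N = t + 1 - m\<close> the event \<open>T > t\<close> is \<open>T \<ge> N + m\<close>. For \<open>t + 1 < m\<close> the exponent of \<open>\<rho>\<close> is negative
and the bound is at least \<open>1\<close>.\<close>

lemma survival_rate:
  assumes \<mu>: "\<mu> \<in> space (prob_algebra M)" and fin: "(\<integral>\<^sup>+ x. ennreal (V x) \<partial>\<mu>) < \<infinity>"
  shows "\<P>(\<omega> in run \<mu>. enat t < regen_time \<omega>) \<le> (\<integral>x. V x \<partial>\<mu>) powr r * \<rho> powi (int t + 1 - int m)"
proof -
  interpret R: prob_space "run \<mu>" by (rule run_prob_space(1)[OF \<mu>])
  note \<rho> = rate(1,2)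
  let ?a = "\<integral>x. V x \<partial>\<mu>"
  have V: "V \<in> borel_measurable \<mu>" by (simp add: measurable_cong_sets[OF law_props(1)[OF \<mu>] refl])
  have "\<And>y. y \<in> space \<mu> \<Longrightarrow> 0 \<le> V y"
    using V_ge_1 law_props(2)[OF \<mu>] by force
  then have "integrable \<mu> V" "AE y in \<mu>. 0 \<le> V y"
    using fin V by (auto intro!: integrableI_nonneg)
  then have a: "(\<integral>\<^sup>+ x. ennreal (V x) \<partial>\<mu>) = ennreal ?a" by (rule nn_integral_eq_integral)
  have a1: "1 \<le> ?a" using one_le_law_V[OF \<mu>] unfolding a by simp
  show ?thesis
  proof (cases "m \<le> t + 1")
    case True
    define N where "N = t + 1 - m"
    have N: "N + m = Suc t" "int t + 1 - int m = int N" using True by (auto simp: N_def)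
    have "ennreal (\<P>(\<omega> in run \<mu>. enat t < regen_time \<omega>)) \<le> (\<integral>\<^sup>+ y. survival_bound N 0 \<infinity> y \<partial>\<mu>)"
      using survival_le[OF \<mu>, of N] by (simp add: N Suc_ile_eq)
    also have "\<dots> \<le> ennreal (\<rho> ^ N) * (\<integral>\<^sup>+ y. ennreal (V y powr r) \<partial>\<mu>)"
      using mean_survival_bound_le[OF \<mu>, of N 0] by simp
    also have "\<dots> \<le> ennreal (\<rho> ^ N) * ennreal (?a powr r)"
      using a1 a by (intro mult_left_mono law_V_powr_le \<mu>) auto
    also have "\<dots> = ennreal (?a powr r * \<rho> ^ N)"
      using \<rho> by (simp add: ennreal_mult mult.commute)
    finally show ?thesis
      using \<rho> by (simp add: N(2) ennreal_le_iff)
  next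
    case False
    have "\<P>(\<omega> in run \<mu>. enat t < regen_time \<omega>) \<le> 1 * 1" by simp
    also have "\<dots> \<le> ?a powr r * \<rho> powi (int t + 1 - int m)"
    proof (rule mult_mono)
      show "1 \<le> ?a powr r" using a1 rate by (simp add: ge_one_powr_ge_zero)
      have "1 \<le> inverse \<rho>" using \<rho> by (simp add: one_le_inverse)
      then show "1 \<le> \<rho> powi (int t + 1 - int m)"
        using False by (simp add: power_int_def one_le_power)
    qed auto
    finally show ?thesis .
  qed
qed

end

theorem theorem1p7:
  fixes M :: "'a measure" and P :: "'a \<Rightarrow> 'a measure" and C :: "'a set"
    and V :: "'a \<Rightarrow> real" and lam K \<epsilon> :: real and m :: nat and \<nu> :: "'a measure"
    and Q :: "'a \<times> 'a \<Rightarrow> (nat \<Rightarrow> 'a) measure"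
  assumes kernel: "P \<in> M \<rightarrow>\<^sub>M prob_algebra M"
    and drift: "drift_function M P C V lam K"
    and small: "small_set M P C m \<epsilon> \<nu>"
    and bridge: "bridge_kernel M P C m Q"
  shows "(\<forall>\<mu>\<in>space (prob_algebra M).
            \<P>(\<omega> in run_law M P C m \<epsilon> \<nu> Q \<mu>. regen_time \<omega> < \<infinity>) = 1)
       \<and> (\<forall>\<mu>\<in>space (prob_algebra M). (\<integral>\<^sup>+ x. ennreal (V x) \<partial>\<mu>) < \<infinity> \<longrightarrow>
            (\<forall>t::nat. \<P>(\<omega> in run_law M P C m \<epsilon> \<nu> Q \<mu>. enat t < regen_time \<omega>)
               \<le> (\<integral>x. V x \<partial>\<mu>) powr drift_r lam K m \<epsilon>
                  * drift_rho lam K m \<epsilon> powi (int t + 1 - int m)))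
       \<and> drift_rho lam K m \<epsilon> < 1
       \<and> (\<integral>\<^sup>+ x. ennreal (V x) \<partial>\<nu>) \<le> ennreal ((drift_B lam K m - (1 - \<epsilon>)) / \<epsilon>)"
proof -
  interpret R: regeneration M P C V lam K \<epsilon> m \<nu> Q
    using kernel drift small bridge by (rule regeneration.intro)
  show ?thesis
    using R.regen_time_finite R.survival_rate R.rate(2) R.nu_V_le by blast
qed

end
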